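(* Let $f\in\mathcal S(\mathbb R^n_+)$, $0<\beta<1$ and $1\le p<1/\beta$. Then $$\int_{\mathbb R^n_+\times\mathbb R^n_+}\frac{|f(w)-f(w')|^p}{|w-w'|^{n+p\beta}}\,dw\,dw'\ \ge\ E_{p,\beta}\int_{\mathbb R^n_+}|f(w)|^p\,y^{-p\beta}\,dw,$$ $$E_{p,\beta}=\frac{\pi^{\frac{n-1}2}\,\Gamma(\frac{p\beta+1}2)}{\Gamma(\frac{p\beta+n}2)}\int_0^\infty\big|1-y^{\beta-\frac1p}\big|^p\,|y-1|^{-1-p\beta}\,dy.$$ The constant $E_{p,\beta}$ is optimal, i.e. it is the largest constant for which the inequality holds for all such $f$.
   Context: $\mathbb R^n_+$ is the upper half-space: points are written $w=(x,y)$ with $x\in\mathbb R^{n-1}$ and $y>0$, and $dw=dx\,dy$ is Lebesgue measure. In the weight $y^{-p\beta}$, $y$ is the last coordinate of $w$. $\mathcal S(\mathbb R^n_+)$ is the class of restrictions to $\mathbb R^n_+$ of Schwartz functions on $\mathbb R^n$. *)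

theory Defs
  imports "HOL-Analysis.Analysis"
begin

text \<open>
  The coordinates of a point of \<open>real ^ 'n\<close> are ordered by the linear order on \<open>'n\<close>, so the
  last one is \<open>Max UNIV\<close>. For \<open>CARD('n) = 1\<close> the half-space is the open half-line.
\<close>

definition last_coord :: "real ^ 'n::{finite,linorder} \<Rightarrow> real"
  where "last_coord w = w $ Max UNIV"

definition half_space :: "(real ^ 'n::{finite,linorder}) set"
  where "half_space = {w. last_coord w > 0}"

definition partial :: "'n::finite \<Rightarrow> (real ^ 'n \<Rightarrow> complex) \<Rightarrow> real ^ 'n \<Rightarrow> complex"
  where "partial i f x = frechet_derivative f (at x) (axis i 1)"

definition iter_partial :: "'n::finite list \<Rightarrow> (real ^ 'n \<Rightarrow> complex) \<Rightarrow> real ^ 'n \<Rightarrow> complex"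
  where "iter_partial is f = foldr partial is f"

text \<open>
  The first condition is smoothness: if every iterated partial derivative is Frechet
  differentiable everywhere, then every iterated partial derivative is continuous. The order of
  differentiation is then irrelevant, so the lists range over all multi-indices.
\<close>

definition schwartz :: "(real ^ 'n::finite \<Rightarrow> complex) \<Rightarrow> bool"
  where "schwartz f \<longleftrightarrow>
    (\<forall>is x. iter_partial is f differentiable (at x)) \<and>
    (\<forall>is k. bounded (range (\<lambda>x. norm x ^ k *\<^sub>R iter_partial is f x)))"

text \<open>Only the values on the half-space matter for membership in this class.\<close>

definition schwartz_half :: "(real ^ 'n::{finite,linorder} \<Rightarrow> complex) \<Rightarrow> bool"
  where "schwartz_half f \<longleftrightarrow> (\<exists>g. schwartz g \<and> (\<forall>w\<in>half_space. f w = g w))"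

text \<open>
  The two integrals of the inequality are Lebesgue integrals of nonnegative functions with values
  in \<open>[0, \<infinity>]\<close>. On the diagonal the quotient is \<open>0 / 0 = 0\<close>; the diagonal is a null set.
\<close>

definition gagliardo_integral :: "real \<Rightarrow> real \<Rightarrow> (real ^ 'n::{finite,linorder} \<Rightarrow> complex) \<Rightarrow> ennreal"
  where "gagliardo_integral p \<beta> f =
    (\<integral>\<^sup>+ (w, w') \<in> half_space \<times> half_space.
       ennreal (norm (f w - f w') powr p / norm (w - w') powr (real CARD('n) + p * \<beta>)) \<partial>lborel)"

definition hardy_integral :: "real \<Rightarrow> real \<Rightarrow> (real ^ 'n::{finite,linorder} \<Rightarrow> complex) \<Rightarrow> ennreal"
  where "hardy_integral p \<beta> f =
    (\<integral>\<^sup>+ w \<in> half_space. ennreal (norm (f w) powr p * last_coord w powr (- p * \<beta>)) \<partial>lborel)"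

definition hardy_const :: "nat \<Rightarrow> real \<Rightarrow> real \<Rightarrow> real"
  where "hardy_const n p \<beta> =
    pi powr ((real n - 1) / 2) * Gamma ((p * \<beta> + 1) / 2) / Gamma ((p * \<beta> + real n) / 2) *
    (LBINT y:{0<..}. \<bar>1 - y powr (\<beta> - 1 / p)\<bar> powr p * \<bar>y - 1\<bar> powr (- 1 - p * \<beta>))"

end

theory Submission
  imports Defs "HOL-Probability.Distributions"
begin

text \<open>
  The inequality is a reverse triangle inequality in \<open>L\<^sup>p\<close> of the half-space with the measure
  \<open>y\<^sup>-\<^sup>p\<^sup>\<beta> dw\<close>. Let \<open>e\<close> be the last unit vector, \<open>a = \<beta> - 1/p\<close>, and parametrise the second
  point of a pair as \<open>w' = w + y (u - e)\<close> with \<open>u\<close> in the half-space: \<open>u\<close> is the position of \<open>w'\<close>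
  as seen from \<open>w\<close> after the horizontal translation and the dilation that carry \<open>w\<close> to \<open>e\<close>
  (\<open>half_map\<close>). In the variables \<open>(w, u)\<close> the measure \<open>dw dw' / |w - w'|\<^sup>n\<^sup>+\<^sup>p\<^sup>\<beta>\<close> becomes the product
  of \<open>y\<^sup>-\<^sup>p\<^sup>\<beta> dw\<close> and \<open>|u - e|\<^sup>-\<^sup>n\<^sup>-\<^sup>p\<^sup>\<beta> du\<close> (\<open>half_space_pairs_substitution\<close>). For fixed \<open>u\<close> with
  last coordinate \<open>r\<close>, composing \<open>f\<close> with the linear map \<open>w \<mapsto> w'\<close> multiplies its norm by exactly
  \<open>r\<^sup>a\<close> (\<open>nn_integral_half_map\<close>), so the inner integral is at least \<open>|1 - r\<^sup>a|\<^sup>p \<parallel>f\<parallel>\<^sup>p\<close>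
  (\<open>reverse_triangle_dilated\<close>). Integrating over \<open>u\<close> yields a constant which equals the stated one
  once the horizontal coordinates are integrated out (\<open>nn_integral_kernel_slice\<close>).

  The triangle inequality would be an equality for every \<open>u\<close> if \<open>f\<close> were \<open>y\<^sup>a\<close>, whose norm is
  infinite. The trial functions \<open>(d\<^sup>2 + y\<^sup>2)\<^sup>a\<^sup>/\<^sup>2 G\<close> with the Gaussian \<open>G(w) = exp(-|w|\<^sup>2)\<close> approximate it.
  The difference of two of their values splits into a main part, where only the power of \<open>y\<close> varies
  and which is bounded by the sharp constant times the Hardy integral, and a remainder, where only
  \<open>G\<close> varies and which stays bounded as \<open>d\<close> tends to 0 (\<open>gagliardo_trial_le\<close>,
  \<open>weighted_gaussian_seminorm_finite\<close>). The Hardy integral of the trial functions tends to infinity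
  (\<open>hardy_integral_trial_unbounded\<close>), so the remainder is negligible and no larger constant is
  possible. That the constant is finite also needs no direct estimate: the inequality applied to
  \<open>G\<close> bounds it.
\<close>


section \<open>Integration on coordinate space\<close>

lemma nn_integral_lborel_coordinates:
  fixes F :: "'n::finite \<Rightarrow> real \<Rightarrow> ennreal"
  assumes [measurable]: "\<And>i. F i \<in> borel_measurable borel"
  shows "(\<integral>\<^sup>+x. (\<Prod>i\<in>UNIV. F i (x $ i)) \<partial>(lborel :: (real ^ 'n) measure)) =
    (\<Prod>i\<in>UNIV. \<integral>\<^sup>+s. F i s \<partial>lborel)"
proof -
  define idx where "idx = the_inv (\<lambda>i::'n. axis i (1::real))"
  have inj: "inj (\<lambda>i::'n. axis i (1::real))"
    by (auto simp: inj_def axis_eq_axis)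
  have idx: "idx (axis i 1) = i" for i
    unfolding idx_def by (rule the_inv_f_f[OF inj])
  have basis: "Basis = range (\<lambda>i::'n. axis i (1::real))"
    by (auto simp: Basis_vec_def)
  have prod: "(\<Prod>b\<in>Basis. G (idx b) b) = (\<Prod>i\<in>UNIV. G i (axis i 1))" for G :: "'n \<Rightarrow> real^'n \<Rightarrow> ennreal"
    unfolding basis using inj by (simp add: prod.reindex idx)
  have "(\<integral>\<^sup>+x. (\<Prod>b\<in>Basis. F (idx b) (x \<bullet> b)) \<partial>(lborel :: (real ^ 'n) measure)) =
      (\<Prod>b\<in>(Basis :: (real^'n) set). \<integral>\<^sup>+s. F (idx b) s \<partial>lborel)"
    by (rule nn_integral_lborel_prod) auto
  then show ?thesis
    using prod[of "\<lambda>i b. F i (x \<bullet> b)" for x] prod[of "\<lambda>i b. \<integral>\<^sup>+s. F i s \<partial>lborel"]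
    by (simp add: inner_axis)
qed

text \<open>Singling out one coordinate of a product measure reduces the linear substitutions below to
  translations and dilations of the line.\<close>

lemma nn_integral_lborel_split:
  fixes F :: "'a::euclidean_space \<Rightarrow> ennreal"
  assumes b: "b \<in> Basis" and [measurable]: "F \<in> borel_measurable borel"
  shows "(\<integral>\<^sup>+w. F w \<partial>lborel) =
    (\<integral>\<^sup>+x. (\<integral>\<^sup>+t. F ((\<Sum>c\<in>Basis - {b}. x c *\<^sub>R c) + t *\<^sub>R b) \<partial>lborel)
      \<partial>(\<Pi>\<^sub>M c\<in>Basis - {b}. lborel))"
proof -
  interpret product_sigma_finite "\<lambda>_::'a. lborel :: real measure" ..
  have "(\<integral>\<^sup>+w. F w \<partial>lborel) =
      (\<integral>\<^sup>+x. F (\<Sum>c\<in>Basis. x c *\<^sub>R c) \<partial>(\<Pi>\<^sub>M c\<in>Basis. lborel))"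
    by (simp add: lborel_def[where 'a = 'a] lborel_eq_real nn_integral_distr)
  also have "\<dots> = (\<integral>\<^sup>+x. F (\<Sum>c\<in>Basis. x c *\<^sub>R c) \<partial>(\<Pi>\<^sub>M c\<in>insert b (Basis - {b}). lborel))"
    using b by (simp add: insert_absorb)
  also have "\<dots> = (\<integral>\<^sup>+x. (\<integral>\<^sup>+t. F (\<Sum>c\<in>Basis. (x(b := t)) c *\<^sub>R c) \<partial>lborel)
      \<partial>(\<Pi>\<^sub>M c\<in>Basis - {b}. lborel))"
    using b by (intro product_nn_integral_insert) (auto simp: insert_absorb)
  also have "\<dots> = (\<integral>\<^sup>+x. (\<integral>\<^sup>+t. F ((\<Sum>c\<in>Basis - {b}. x c *\<^sub>R c) + t *\<^sub>R b) \<partial>lborel)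
      \<partial>(\<Pi>\<^sub>M c\<in>Basis - {b}. lborel))"
  proof (intro nn_integral_cong arg_cong[where f = F])
    fix x :: "'a \<Rightarrow> real" and t :: real
    have "(\<Sum>c\<in>Basis. (x(b := t)) c *\<^sub>R c) =
        (x(b := t)) b *\<^sub>R b + (\<Sum>c\<in>Basis - {b}. (x(b := t)) c *\<^sub>R c)"
      using b by (intro sum.remove) auto
    also have "(\<Sum>c\<in>Basis - {b}. (x(b := t)) c *\<^sub>R c) = (\<Sum>c\<in>Basis - {b}. x c *\<^sub>R c)"
      by (intro sum.cong) auto
    finally show "(\<Sum>c\<in>Basis. (x(b := t)) c *\<^sub>R c) =
        (\<Sum>c\<in>Basis - {b}. x c *\<^sub>R c) + t *\<^sub>R b"
      by (simp add: add.commute)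
  qed
  finally show ?thesis .
qed

lemma nn_integral_lborel_shear_coordinate:
  fixes F :: "'a::euclidean_space \<Rightarrow> ennreal"
  assumes b: "b \<in> Basis" and c: "c \<in> Basis" "b \<noteq> c" and [measurable]: "F \<in> borel_measurable borel"
  shows "(\<integral>\<^sup>+w. F (w + ((w \<bullet> c) * k) *\<^sub>R b) \<partial>lborel) = (\<integral>\<^sup>+w. F w \<partial>lborel)"
proof -
  have "(\<integral>\<^sup>+t. F ((z + t *\<^sub>R b) + (((z + t *\<^sub>R b) \<bullet> c) * k) *\<^sub>R b) \<partial>lborel) =
      (\<integral>\<^sup>+t. F (z + t *\<^sub>R b) \<partial>lborel)" for z
  proof -
    have *: "(z + t *\<^sub>R b) + (((z + t *\<^sub>R b) \<bullet> c) * k) *\<^sub>R b = z + ((z \<bullet> c) * k + 1 * t) *\<^sub>R b" for t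
      using b c by (simp add: inner_add_left inner_Basis scaleR_add_left algebra_simps)
    show ?thesis
      unfolding * using nn_integral_real_affine[of "\<lambda>t. F (z + t *\<^sub>R b)" 1 "(z \<bullet> c) * k"]
      by simp
  qed
  then show ?thesis
    using b by (subst (1 2) nn_integral_lborel_split[OF b]) simp_all
qed

text \<open>The shear is a composition of coordinate shears, one for each coordinate of \<open>v\<close>: none of them
  changes \<open>w \<bullet> c\<close>, so they do not interfere.\<close>

lemma nn_integral_lborel_shear:
  fixes F :: "'a::euclidean_space \<Rightarrow> ennreal"
  assumes c: "c \<in> Basis" and v: "v \<bullet> c = 0" and F: "F \<in> borel_measurable borel"
  shows "(\<integral>\<^sup>+w. F (w + (w \<bullet> c) *\<^sub>R v) \<partial>lborel) = (\<integral>\<^sup>+w. F w \<partial>lborel)"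
proof -
  have "(\<integral>\<^sup>+w. F (w + (w \<bullet> c) *\<^sub>R (\<Sum>b\<in>A. (v \<bullet> b) *\<^sub>R b)) \<partial>lborel) = (\<integral>\<^sup>+w. F w \<partial>lborel)"
    if "finite A" "A \<subseteq> Basis - {c}" for A
    using that F
  proof (induction A arbitrary: F)
    case empty
    then show ?case by simp
  next
    case (insert b A)
    note [measurable] = insert.prems(2)
    let ?s = "\<lambda>w. w + (w \<bullet> c) *\<^sub>R (\<Sum>b\<in>A. (v \<bullet> b) *\<^sub>R b)"
    let ?G = "\<lambda>w. F (w + ((w \<bullet> c) * (v \<bullet> b)) *\<^sub>R b)"
    have "(\<Sum>b\<in>A. (v \<bullet> b) *\<^sub>R b) \<bullet> c = 0"
      unfolding inner_sum_left using insert.prems(1) c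
      by (intro sum.neutral) (auto simp: inner_not_same_Basis subset_iff)
    then have "F (w + (w \<bullet> c) *\<^sub>R (\<Sum>b\<in>insert b A. (v \<bullet> b) *\<^sub>R b)) = ?G (?s w)" for w
      using insert.hyps by (simp add: algebra_simps)
    then have "(\<integral>\<^sup>+w. F (w + (w \<bullet> c) *\<^sub>R (\<Sum>b\<in>insert b A. (v \<bullet> b) *\<^sub>R b)) \<partial>lborel) =
        (\<integral>\<^sup>+w. ?G (?s w) \<partial>lborel)"
      by simp
    also have "\<dots> = (\<integral>\<^sup>+w. ?G w \<partial>lborel)"
      using insert.prems(1) by (intro insert.IH) auto
    also have "\<dots> = (\<integral>\<^sup>+w. F w \<partial>lborel)"
      using insert.prems c by (intro nn_integral_lborel_shear_coordinate) auto
    finally show ?case .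
  qed
  from this[of "Basis - {c}"] have
    "(\<integral>\<^sup>+w. F (w + (w \<bullet> c) *\<^sub>R (\<Sum>b\<in>Basis - {c}. (v \<bullet> b) *\<^sub>R b)) \<partial>lborel) = (\<integral>\<^sup>+w. F w \<partial>lborel)"
    by simp
  moreover have "(\<Sum>b\<in>Basis - {c}. (v \<bullet> b) *\<^sub>R b) = v"
    using sum.remove[OF finite_Basis c, of "\<lambda>b. (v \<bullet> b) *\<^sub>R b"] v
    by (simp add: euclidean_representation)
  ultimately show ?thesis by simp
qed

lemma nn_integral_lborel_scale_coordinate:
  fixes F :: "'a::euclidean_space \<Rightarrow> ennreal"
  assumes c: "c \<in> Basis" and r: "0 < r" and [measurable]: "F \<in> borel_measurable borel"
  shows "(\<integral>\<^sup>+w. F (w + ((w \<bullet> c) * (r - 1)) *\<^sub>R c) \<partial>lborel) = ennreal (1 / r) * (\<integral>\<^sup>+w. F w \<partial>lborel)"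
proof -
  let ?M = "\<Pi>\<^sub>M c\<in>Basis - {c}. (lborel :: real measure)"
  let ?z = "\<lambda>x. \<Sum>b\<in>Basis - {c}. x b *\<^sub>R b"
  have *: "(\<integral>\<^sup>+t. F ((?z x + t *\<^sub>R c) + (((?z x + t *\<^sub>R c) \<bullet> c) * (r - 1)) *\<^sub>R c) \<partial>lborel) =
      ennreal (1 / r) * (\<integral>\<^sup>+t. F (?z x + t *\<^sub>R c) \<partial>lborel)" for x
  proof -
    have "?z x \<bullet> c = 0"
      unfolding inner_sum_left using c by (intro sum.neutral) (auto simp: inner_Basis)
    then have "(?z x + t *\<^sub>R c) + (((?z x + t *\<^sub>R c) \<bullet> c) * (r - 1)) *\<^sub>R c = ?z x + (r * t) *\<^sub>R c" for t
      using c by (simp add: inner_add_left scaleR_add_left[symmetric] algebra_simps)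
    then have "(\<integral>\<^sup>+t. F ((?z x + t *\<^sub>R c) + (((?z x + t *\<^sub>R c) \<bullet> c) * (r - 1)) *\<^sub>R c) \<partial>lborel) =
        (\<integral>\<^sup>+t. F (?z x + (r * t) *\<^sub>R c) \<partial>lborel)"
      by (intro nn_integral_cong) (simp only:)
    also have "\<dots> = ennreal (1 / r) * (ennreal r * (\<integral>\<^sup>+t. F (?z x + (r * t) *\<^sub>R c) \<partial>lborel))"
      using r by (simp add: mult.assoc[symmetric] ennreal_mult[symmetric])
    also have "ennreal r * (\<integral>\<^sup>+t. F (?z x + (r * t) *\<^sub>R c) \<partial>lborel) = (\<integral>\<^sup>+t. F (?z x + t *\<^sub>R c) \<partial>lborel)"
      using nn_integral_real_affine[of "\<lambda>t. F (?z x + t *\<^sub>R c)" r 0] r by simp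
    finally show ?thesis .
  qed
  have "(\<integral>\<^sup>+w. F (w + ((w \<bullet> c) * (r - 1)) *\<^sub>R c) \<partial>lborel) =
      (\<integral>\<^sup>+x. ennreal (1 / r) * (\<integral>\<^sup>+t. F (?z x + t *\<^sub>R c) \<partial>lborel) \<partial>?M)"
    by (subst nn_integral_lborel_split[OF c]) (simp_all add: *)
  also have "\<dots> = ennreal (1 / r) * (\<integral>\<^sup>+x. (\<integral>\<^sup>+t. F (?z x + t *\<^sub>R c) \<partial>lborel) \<partial>?M)"
    by (intro nn_integral_cmult) measurable
  also have "\<dots> = ennreal (1 / r) * (\<integral>\<^sup>+w. F w \<partial>lborel)"
    by (subst nn_integral_lborel_split[OF c]) simp_all
  finally show ?thesis .
qed

text \<open>The matrix of the map below is the identity with one column replaced by \<open>u\<close>, so its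
  determinant is \<open>u \<bullet> c\<close>.\<close>

lemma nn_integral_lborel_replace_axis:
  fixes F :: "'a::euclidean_space \<Rightarrow> ennreal"
  assumes c: "c \<in> Basis" and u: "0 < u \<bullet> c" and [measurable]: "F \<in> borel_measurable borel"
  shows "(\<integral>\<^sup>+w. F (w + (w \<bullet> c) *\<^sub>R (u - c)) \<partial>lborel) =
    ennreal (1 / (u \<bullet> c)) * (\<integral>\<^sup>+w. F w \<partial>lborel)"
proof -
  let ?v = "u - (u \<bullet> c) *\<^sub>R c"
  let ?G = "\<lambda>w. F (w + ((w \<bullet> c) * (u \<bullet> c - 1)) *\<^sub>R c)"
  have v: "?v \<bullet> c = 0"
    using c by (simp add: inner_diff_left)
  have "F (w + (w \<bullet> c) *\<^sub>R (u - c)) = ?G (w + (w \<bullet> c) *\<^sub>R ?v)" for w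
    unfolding inner_add_left inner_scaleR_left v by (simp add: algebra_simps)
  then have "(\<integral>\<^sup>+w. F (w + (w \<bullet> c) *\<^sub>R (u - c)) \<partial>lborel) = (\<integral>\<^sup>+w. ?G (w + (w \<bullet> c) *\<^sub>R ?v) \<partial>lborel)"
    by simp
  also have "\<dots> = (\<integral>\<^sup>+w. ?G w \<partial>lborel)"
    using c v by (intro nn_integral_lborel_shear) auto
  also have "\<dots> = ennreal (1 / (u \<bullet> c)) * (\<integral>\<^sup>+w. F w \<partial>lborel)"
    using c u by (intro nn_integral_lborel_scale_coordinate) auto
  finally show ?thesis .
qed

lemma nn_integral_lborel_affine:
  fixes F :: "'a::euclidean_space \<Rightarrow> ennreal"
  assumes "0 < r" and [measurable]: "F \<in> borel_measurable borel"
  shows "(\<integral>\<^sup>+w. F w \<partial>lborel) = ennreal (r ^ DIM('a)) * (\<integral>\<^sup>+u. F (t + r *\<^sub>R u) \<partial>lborel)"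
  using assms(1)
  by (subst lborel_affine[of r t]) (simp_all add: nn_integral_density nn_integral_distr nn_integral_cmult)


section \<open>Integrating out the horizontal coordinates of the kernel\<close>

lemma nn_integral_gaussian:
  fixes t :: real
  assumes t: "0 < t"
  shows "(\<integral>\<^sup>+s. ennreal (exp (- t * s\<^sup>2)) \<partial>lborel) = ennreal (sqrt (pi / t))"
proof -
  \<comment> \<open>The standard deviation whose normal density is proportional to the integrand.\<close>
  define \<sigma> where "\<sigma> = sqrt (1 / (2 * t))"
  have \<sigma>: "0 < \<sigma>" "\<sigma>\<^sup>2 = 1 / (2 * t)"
    using t by (auto simp: \<sigma>_def)
  have "exp (- t * s\<^sup>2) = sqrt (pi / t) * normal_density 0 \<sigma> s" for s
  proof -
    have "t * s\<^sup>2 = s\<^sup>2 / (2 * \<sigma>\<^sup>2)" "pi / t = 2 * pi * \<sigma>\<^sup>2"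
      using t by (auto simp: \<sigma>(2))
    then show ?thesis
      using t \<sigma>(1) by (simp add: normal_density_def)
  qed
  then have "(\<integral>\<^sup>+s. ennreal (exp (- t * s\<^sup>2)) \<partial>lborel) =
      ennreal (sqrt (pi / t)) * (\<integral>\<^sup>+s. ennreal (normal_density 0 \<sigma> s) \<partial>lborel)"
    using t by (simp add: ennreal_mult nn_integral_cmult)
  also have "(\<integral>\<^sup>+s. ennreal (normal_density 0 \<sigma> s) \<partial>lborel) = 1"
    using \<sigma>(1) by (subst nn_integral_eq_integral) simp_all
  finally show ?thesis by simp
qed

lemma nn_integral_gaussian_slice:
  fixes g :: "real \<Rightarrow> ennreal" and i :: "'n::finite"
  assumes t: "0 < t" and [measurable]: "g \<in> borel_measurable borel"
  shows "(\<integral>\<^sup>+v. g (v $ i) * ennreal (exp (- t * (norm v)\<^sup>2)) \<partial>(lborel :: (real ^ 'n) measure)) =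
    ennreal ((pi / t) powr ((real CARD('n) - 1) / 2)) * (\<integral>\<^sup>+s. g s * ennreal (exp (- t * s\<^sup>2)) \<partial>lborel)"
proof -
  define F where "F = (\<lambda>j s. (if j = i then g s else 1) * ennreal (exp (- t * s\<^sup>2)))"
  have [measurable]: "F j \<in> borel_measurable borel" for j
    unfolding F_def by measurable
  have "g (v $ i) * ennreal (exp (- t * (norm v)\<^sup>2)) = (\<Prod>j\<in>UNIV. F j (v $ j))" for v :: "real ^ 'n"
  proof -
    have "(norm v)\<^sup>2 = (\<Sum>j\<in>UNIV. (v $ j)\<^sup>2)"
      unfolding power2_norm_eq_inner inner_vec_def by (simp add: power2_eq_square)
    then have "- t * (norm v)\<^sup>2 = (\<Sum>j\<in>UNIV. - t * (v $ j)\<^sup>2)"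
      by (simp only: sum_distrib_left)
    then have "ennreal (exp (- t * (norm v)\<^sup>2)) = (\<Prod>j\<in>UNIV. ennreal (exp (- t * (v $ j)\<^sup>2)))"
      by (simp only: exp_sum finite prod_ennreal exp_ge_zero)
    then show ?thesis
      by (simp add: F_def prod.distrib prod.delta)
  qed
  then have "(\<integral>\<^sup>+v. g (v $ i) * ennreal (exp (- t * (norm v)\<^sup>2)) \<partial>(lborel :: (real ^ 'n) measure)) =
      (\<Prod>j\<in>UNIV. \<integral>\<^sup>+s. F j s \<partial>lborel)"
    by (simp add: nn_integral_lborel_coordinates)
  also have "\<dots> = (\<integral>\<^sup>+s. F i s \<partial>lborel) * (\<Prod>j\<in>UNIV - {i}. \<integral>\<^sup>+s. F j s \<partial>lborel)"
    by (intro prod.remove) auto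
  also have "(\<Prod>j\<in>UNIV - {i}. \<integral>\<^sup>+s. F j s \<partial>lborel) = (\<Prod>j\<in>UNIV - {i}. ennreal (sqrt (pi / t)))"
    using nn_integral_gaussian[OF t] by (intro prod.cong) (auto simp: F_def)
  also have "\<dots> = ennreal (sqrt (pi / t) ^ (CARD('n) - 1))"
    using t by (simp add: card_Diff_singleton ennreal_power)
  also have "sqrt (pi / t) ^ (CARD('n) - 1) = (pi / t) powr (1 / 2 * real (CARD('n) - 1))"
    using t by (simp only: powr_half_sqrt powr_realpow powr_powr[symmetric] real_sqrt_gt_zero
        divide_pos_pos pi_gt_zero less_imp_le)
  also have "1 / 2 * real (CARD('n) - 1) = (real CARD('n) - 1) / 2"
    by (simp add: of_nat_diff Suc_le_eq)
  finally show ?thesis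
    by (simp add: F_def mult.commute)
qed

lemma nn_integral_Gamma:
  fixes a q :: real
  assumes a: "0 < a" and q: "0 < q"
  shows "(\<integral>\<^sup>+t\<in>{0<..}. ennreal (t powr (q - 1) * exp (- t * a)) \<partial>lborel) = ennreal (Gamma q * a powr (- q))"
proof -
  let ?f = "\<lambda>t::real. ennreal (t powr (q - 1) * exp (- t)) * indicator {0<..} t"
  have 1: "(\<integral>\<^sup>+t. ?f t \<partial>lborel) = ennreal (Gamma q)"
  proof -
    have "(\<integral>\<^sup>+t. ennreal (indicator {0..} t * (t powr (q - 1) / exp t)) \<partial>lborel) = ennreal (Gamma q)"
      using nn_integral_has_integral_lebesgue[OF _ Gamma_integral_real[OF q]] by simp
    moreover have "AE t in lborel. ?f t = ennreal (indicator {0..} t * (t powr (q - 1) / exp t))"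
      using AE_lborel_singleton[of "0::real"]
      by eventually_elim (auto simp: indicator_def exp_minus field_simps)
    ultimately show ?thesis
      using nn_integral_cong_AE by fastforce
  qed
  have "ennreal (Gamma q) = ennreal a * (\<integral>\<^sup>+t. ?f (a * t) \<partial>lborel)"
    using nn_integral_real_affine[of ?f a 0] a 1 by simp
  also have "(\<integral>\<^sup>+t. ?f (a * t) \<partial>lborel) =
      (\<integral>\<^sup>+t. ennreal (a powr (q - 1)) * (ennreal (t powr (q - 1) * exp (- t * a)) * indicator {0<..} t) \<partial>lborel)"
    using a by (intro nn_integral_cong)
      (auto simp: indicator_def powr_mult ennreal_mult[symmetric] zero_less_mult_iff mult_ac)
  also have "\<dots> = ennreal (a powr (q - 1)) * (\<integral>\<^sup>+t\<in>{0<..}. ennreal (t powr (q - 1) * exp (- t * a)) \<partial>lborel)"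
    (is "_ = _ * ?I") by (intro nn_integral_cmult) measurable
  finally have "ennreal (Gamma q) = (ennreal a * ennreal (a powr (q - 1))) * ?I"
    by (simp only: mult.assoc)
  also have "ennreal a * ennreal (a powr (q - 1)) = ennreal (a powr q)"
    using a by (simp add: ennreal_mult[symmetric] powr_diff)
  finally have "ennreal (Gamma q) = ennreal (a powr q) * ?I" .
  then have "ennreal (a powr (- q)) * ennreal (Gamma q) = (ennreal (a powr (- q)) * ennreal (a powr q)) * ?I"
    by (simp only: mult.assoc)
  also have "ennreal (a powr (- q)) * ennreal (a powr q) = 1"
    using a by (simp add: ennreal_mult[symmetric] powr_add[symmetric])
  finally have "?I = ennreal (a powr (- q)) * ennreal (Gamma q)"
    by simp
  also have "\<dots> = ennreal (Gamma q * a powr (- q))"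
    using q by (subst ennreal_mult[symmetric]) (auto simp: mult.commute)
  finally show ?thesis .
qed

lemma nn_integral_Gamma_norm:
  fixes v :: "'a::real_normed_vector"
  assumes "v \<noteq> 0" and m: "0 < m"
  shows "(\<integral>\<^sup>+t\<in>{0<..}. ennreal (t powr (m / 2 - 1) * exp (- t * (norm v)\<^sup>2)) \<partial>lborel) =
    ennreal (Gamma (m / 2)) * ennreal (norm v powr (- m))"
proof -
  have "((norm v)\<^sup>2) powr (- (m / 2)) = norm v powr (- m)"
    using assms powr_powr[of "norm v" 2 "- (m / 2)"] by simp
  then show ?thesis
    using nn_integral_Gamma[of "(norm v)\<^sup>2" "m / 2"] assms Gamma_real_pos[of "m / 2"]
    by (simp add: ennreal_mult less_imp_le)
qed

text \<open>Writing the kernel as a Gamma integral of Gaussians makes its coordinates independent, so the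
  other coordinates integrate out without polar coordinates.\<close>

lemma nn_integral_kernel_slice:
  fixes g :: "real \<Rightarrow> ennreal" and i :: "'n::finite" and q :: real
  assumes q: "-1 < q" and [measurable]: "g \<in> borel_measurable borel"
  defines "N \<equiv> real CARD('n)"
  shows "(\<integral>\<^sup>+v. g (v $ i) * ennreal (norm v powr (- (N + q))) \<partial>(lborel :: (real ^ 'n) measure)) =
    ennreal (pi powr ((N - 1) / 2) * Gamma ((q + 1) / 2) / Gamma ((q + N) / 2)) *
    (\<integral>\<^sup>+s. g s * ennreal (\<bar>s\<bar> powr (- (1 + q))) \<partial>lborel)"
    (is "?L = ?c * ?R")
proof -
  have N: "N \<ge> 1"
    unfolding N_def using card_gt_0_iff[of "UNIV :: 'n set"] by simp
  let ?V = "lborel :: (real ^ 'n) measure"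
  let ?w = "\<lambda>m t. ennreal (t powr (m / 2 - 1)) * indicator {0<..} (t::real)"
  have pos: "0 < Gamma ((N + q) / 2)" "0 < Gamma ((1 + q) / 2)"
    using N q by (auto intro!: Gamma_real_pos)
  have split: "ennreal (t powr m * exp x) * indicator A t = ennreal (t powr m) * indicator A t * ennreal (exp x)"
    for t m x :: real and A
    by (simp add: ennreal_mult mult_ac)
  have kern: "ennreal (Gamma (m / 2)) * (\<integral>\<^sup>+v. h v * ennreal (norm v powr (- m)) \<partial>lborel) =
      (\<integral>\<^sup>+t. ?w m t * (\<integral>\<^sup>+v. h v * ennreal (exp (- t * (norm v)\<^sup>2)) \<partial>lborel) \<partial>lborel)"
    if m: "0 < m" and [measurable]: "h \<in> borel_measurable borel" for m :: real and h :: "'a::euclidean_space \<Rightarrow> ennreal"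
  proof -
    have "ennreal (Gamma (m / 2)) * (\<integral>\<^sup>+v. h v * ennreal (norm v powr (- m)) \<partial>lborel) =
        (\<integral>\<^sup>+v. ennreal (Gamma (m / 2)) * (h v * ennreal (norm v powr (- m))) \<partial>lborel)"
      by (intro nn_integral_cmult[symmetric]) measurable
    also have "\<dots> = (\<integral>\<^sup>+v. h v * (\<integral>\<^sup>+t. ?w m t * ennreal (exp (- t * (norm v)\<^sup>2)) \<partial>lborel) \<partial>lborel)"
    proof (rule nn_integral_cong_AE)
      show "AE v in lborel. ennreal (Gamma (m / 2)) * (h v * ennreal (norm v powr (- m))) =
          h v * (\<integral>\<^sup>+t. ?w m t * ennreal (exp (- t * (norm v)\<^sup>2)) \<partial>lborel)"
        using AE_lborel_singleton[of "0::'a"]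
      proof eventually_elim
        case (elim v)
        show ?case
          using nn_integral_Gamma_norm[OF elim m] unfolding split by (simp add: mult_ac)
      qed
    qed
    also have "\<dots> = (\<integral>\<^sup>+v. (\<integral>\<^sup>+t. h v * (?w m t * ennreal (exp (- t * (norm v)\<^sup>2))) \<partial>lborel) \<partial>lborel)"
      by (intro nn_integral_cong nn_integral_cmult[symmetric]) measurable
    also have "\<dots> = (\<integral>\<^sup>+t. (\<integral>\<^sup>+v. h v * (?w m t * ennreal (exp (- t * (norm v)\<^sup>2))) \<partial>lborel) \<partial>lborel)"
      by (rule lborel_pair.Fubini') measurable
    also have "\<dots> = (\<integral>\<^sup>+t. (\<integral>\<^sup>+v. ?w m t * (h v * ennreal (exp (- t * (norm v)\<^sup>2))) \<partial>lborel) \<partial>lborel)"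
      by (simp add: mult_ac)
    also have "\<dots> = (\<integral>\<^sup>+t. ?w m t * (\<integral>\<^sup>+v. h v * ennreal (exp (- t * (norm v)\<^sup>2)) \<partial>lborel) \<partial>lborel)"
      by (intro nn_integral_cong nn_integral_cmult) measurable
    finally show ?thesis .
  qed
  have "ennreal (Gamma ((N + q) / 2)) * ?L =
      (\<integral>\<^sup>+t. ?w (N + q) t * (\<integral>\<^sup>+v. g (v $ i) * ennreal (exp (- t * (norm v)\<^sup>2)) \<partial>?V) \<partial>lborel)"
    using N q by (intro kern) auto
  also have "\<dots> = (\<integral>\<^sup>+t. ennreal (pi powr ((N - 1) / 2)) *
      (?w (1 + q) t * (\<integral>\<^sup>+s. g s * ennreal (exp (- t * s\<^sup>2)) \<partial>lborel)) \<partial>lborel)"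
  proof (rule nn_integral_cong)
    fix t :: real
    show "?w (N + q) t * (\<integral>\<^sup>+v. g (v $ i) * ennreal (exp (- t * (norm v)\<^sup>2)) \<partial>?V) =
        ennreal (pi powr ((N - 1) / 2)) * (?w (1 + q) t * (\<integral>\<^sup>+s. g s * ennreal (exp (- t * s\<^sup>2)) \<partial>lborel))"
    proof (cases "0 < t")
      case True
      have "t powr ((N + q) / 2 - 1) * (pi / t) powr ((N - 1) / 2) =
          pi powr ((N - 1) / 2) * t powr ((1 + q) / 2 - 1)"
      proof -
        have "(N + q) / 2 - 1 = ((1 + q) / 2 - 1) + (N - 1) / 2"
          by (simp add: field_simps)
        then have "t powr ((N + q) / 2 - 1) = t powr ((1 + q) / 2 - 1) * t powr ((N - 1) / 2)"
          using powr_add by metis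
        then show ?thesis
          using True by (simp add: powr_divide)
      qed
      then have "ennreal (t powr ((N + q) / 2 - 1)) * ennreal ((pi / t) powr ((N - 1) / 2)) =
          ennreal (pi powr ((N - 1) / 2)) * ennreal (t powr ((1 + q) / 2 - 1))"
        by (simp add: ennreal_mult[symmetric])
      then show ?thesis
        unfolding nn_integral_gaussian_slice[OF True assms(2)] N_def[symmetric]
        using True by (simp only: indicator_simps greaterThan_iff mult_1_right mult.assoc[symmetric])
    qed simp
  qed
  also have "\<dots> = ennreal (pi powr ((N - 1) / 2)) *
      (\<integral>\<^sup>+t. ?w (1 + q) t * (\<integral>\<^sup>+s. g s * ennreal (exp (- t * (norm s)\<^sup>2)) \<partial>lborel) \<partial>lborel)"
    by (subst nn_integral_cmult) (simp_all only: real_norm_def power2_abs, measurable)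
  also have "(\<integral>\<^sup>+t. ?w (1 + q) t * (\<integral>\<^sup>+s. g s * ennreal (exp (- t * (norm s)\<^sup>2)) \<partial>lborel) \<partial>lborel) =
      ennreal (Gamma ((1 + q) / 2)) * ?R"
    using q kern[of "1 + q" g] by simp
  finally have eq: "ennreal (Gamma ((N + q) / 2)) * ?L =
      ennreal (pi powr ((N - 1) / 2)) * (ennreal (Gamma ((1 + q) / 2)) * ?R)" .
  have "?L = (ennreal (1 / Gamma ((N + q) / 2)) * ennreal (Gamma ((N + q) / 2))) * ?L"
    using pos by (simp add: ennreal_mult[symmetric])
  also have "\<dots> = ennreal (1 / Gamma ((N + q) / 2)) * (ennreal (pi powr ((N - 1) / 2)) *
      (ennreal (Gamma ((1 + q) / 2)) * ?R))"
    by (simp only: mult.assoc eq)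
  also have "\<dots> = (ennreal (1 / Gamma ((N + q) / 2)) * ennreal (pi powr ((N - 1) / 2)) *
      ennreal (Gamma ((1 + q) / 2))) * ?R"
    by (simp only: mult.assoc)
  also have "ennreal (1 / Gamma ((N + q) / 2)) * ennreal (pi powr ((N - 1) / 2)) *
      ennreal (Gamma ((1 + q) / 2)) = ?c"
    using pos by (subst ennreal_mult[symmetric], simp, simp)+ (simp add: add.commute)
  finally show ?thesis .
qed


section \<open>Pairs of points of the half-space\<close>

abbreviation last_axis :: "real ^ 'n::{finite,linorder}"
  where "last_axis \<equiv> axis (Max UNIV) 1"

text \<open>The dilation by the last coordinate of \<open>w\<close>, followed by the horizontal translation that carries
  \<open>last_axis\<close> to \<open>w\<close>, evaluated at \<open>u\<close>. It is affine in \<open>u\<close> for fixed \<open>w\<close> and linear in \<open>w\<close> for fixed \<open>u\<close>.\<close>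

definition half_map :: "real ^ 'n::{finite,linorder} \<Rightarrow> real ^ 'n::_ \<Rightarrow> real ^ 'n::_"
  where "half_map u w = w + last_coord w *\<^sub>R (u - last_axis)"

lemma last_coord_inner: "last_coord w = w \<bullet> last_axis"
  by (simp add: last_coord_def inner_axis)

lemma last_axis_Basis: "last_axis \<in> (Basis :: (real ^ 'n::{finite,linorder}) set)"
  by (auto simp: Basis_vec_def)

lemma last_coord_simps [simp]:
  "last_coord (v + w) = last_coord v + last_coord w"
  "last_coord (v - w) = last_coord v - last_coord w"
  "last_coord (r *\<^sub>R w) = r * last_coord w"
  "last_coord (last_axis :: real ^ 'n::{finite,linorder}) = 1"
  by (simp_all add: last_coord_def)

lemma last_coord_measurable [measurable]: "last_coord \<in> borel_measurable borel"
  unfolding last_coord_inner[abs_def] by measurable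

lemma half_space_measurable [measurable]: "half_space \<in> sets borel"
  unfolding half_space_def by measurable

lemma last_coord_half_map [simp]: "last_coord (half_map u w) = last_coord u * last_coord w"
  by (simp add: half_map_def algebra_simps)

lemma half_map_measurable [measurable]:
  "(\<lambda>x. half_map (f x) (g x)) \<in> borel_measurable M"
  if [measurable]: "f \<in> borel_measurable M" "g \<in> borel_measurable M"
  unfolding half_map_def by measurable

lemma indicator_half_space_half_map:
  "w \<in> half_space \<Longrightarrow> indicator half_space (half_map u w) = indicator half_space u"
  by (simp add: half_space_def indicator_def zero_less_mult_iff)

lemma norm_diff_half_map: "norm (w - half_map u w) = \<bar>last_coord w\<bar> * norm (u - last_axis)"
  by (simp add: half_map_def)

text \<open>For fixed \<open>w\<close> the map \<open>u \<mapsto> half_map u w\<close> preserves the half-space and has Jacobian \<open>y\<^sup>n\<close>, while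
  the distance of \<open>w\<close> to its value is \<open>y |u - e|\<close>; the powers of \<open>y\<close> combine to \<open>y\<^sup>-\<^sup>q\<close>.\<close>

lemma half_space_pairs_substitution:
  fixes \<Phi> :: "real ^ 'n::{finite,linorder} \<Rightarrow> real ^ 'n::_ \<Rightarrow> ennreal" and q :: real
  assumes [measurable]: "case_prod \<Phi> \<in> borel_measurable borel"
  shows "(\<integral>\<^sup>+x\<in>half_space \<times> half_space. (case x of (w, w') \<Rightarrow>
      \<Phi> w w' * ennreal (norm (w - w') powr (- (real CARD('n) + q)))) \<partial>lborel) =
    (\<integral>\<^sup>+u\<in>half_space. ennreal (norm (u - last_axis) powr (- (real CARD('n) + q))) *
      (\<integral>\<^sup>+w\<in>half_space. \<Phi> w (half_map u w) * ennreal (last_coord w powr (- q)) \<partial>lborel) \<partial>lborel)"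
proof -
  let ?H = "half_space :: (real ^ 'n::_) set"
  let ?k = "\<lambda>v::real ^ 'n::_. ennreal (norm v powr (- (real CARD('n) + q)))"
  have [measurable]: "case_prod \<Phi> \<in> borel_measurable (borel \<Otimes>\<^sub>M borel)"
    using assms by (simp add: borel_prod)
  have [measurable]: "(\<lambda>x. \<Phi> (f x) (g x)) \<in> borel_measurable M"
    if [measurable]: "f \<in> borel_measurable M" "g \<in> borel_measurable M" for f g and M :: "'b measure"
  proof -
    have "(\<lambda>x. (f x, g x)) \<in> M \<rightarrow>\<^sub>M borel \<Otimes>\<^sub>M borel" by measurable
    from measurable_compose[OF this, of "case_prod \<Phi>"] show ?thesis by simp
  qed
  have regroup: "a * (x * b * i) = x * c * d * i" if "a * b = c * d" for a b c d x i :: ennreal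
  proof -
    have "a * (x * b * i) = (a * b) * (x * i)"
      by (simp only: mult_ac)
    then show ?thesis
      unfolding that by (simp only: mult_ac)
  qed
  have "(\<integral>\<^sup>+x\<in>?H \<times> ?H. (case x of (w, w') \<Rightarrow> \<Phi> w w' * ?k (w - w')) \<partial>lborel) =
      (\<integral>\<^sup>+x. (case x of (w, w') \<Rightarrow> \<Phi> w w' * ?k (w - w') * (indicator ?H w * indicator ?H w'))
        \<partial>(lborel \<Otimes>\<^sub>M lborel))"
    unfolding lborel_prod by (intro nn_integral_cong) (auto simp: indicator_times)
  also have "\<dots> = (\<integral>\<^sup>+w. (\<integral>\<^sup>+w'. \<Phi> w w' * ?k (w - w') * (indicator ?H w * indicator ?H w') \<partial>lborel) \<partial>lborel)"
    by (subst lborel.nn_integral_fst[symmetric]) simp_all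
  also have "\<dots> = (\<integral>\<^sup>+w. (\<integral>\<^sup>+u. \<Phi> w (half_map u w) * ennreal (last_coord w powr (- q)) *
      ?k (u - last_axis) * (indicator ?H w * indicator ?H u) \<partial>lborel) \<partial>lborel)"
  proof (rule nn_integral_cong)
    fix w :: "real ^ 'n::_"
    show "(\<integral>\<^sup>+w'. \<Phi> w w' * ?k (w - w') * (indicator ?H w * indicator ?H w') \<partial>lborel) =
      (\<integral>\<^sup>+u. \<Phi> w (half_map u w) * ennreal (last_coord w powr (- q)) *
      ?k (u - last_axis) * (indicator ?H w * indicator ?H u) \<partial>lborel)"
    proof (cases "w \<in> ?H")
      case True
      define y where "y = last_coord w"
      have y: "0 < y"
        using True by (simp add: y_def half_space_def)
      have map: "(w - y *\<^sub>R last_axis) + y *\<^sub>R u = half_map u w" for u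
        by (simp add: half_map_def y_def algebra_simps)
      have "(\<integral>\<^sup>+w'. \<Phi> w w' * ?k (w - w') * (indicator ?H w * indicator ?H w') \<partial>lborel) =
          ennreal (y ^ CARD('n)) * (\<integral>\<^sup>+u. \<Phi> w (half_map u w) * ?k (w - half_map u w) *
            (indicator ?H w * indicator ?H (half_map u w)) \<partial>lborel)"
        by (subst nn_integral_lborel_affine[OF y, of _ "w - y *\<^sub>R last_axis"]) (simp_all only: map, simp_all)
      also have "\<dots> = (\<integral>\<^sup>+u. ennreal (y ^ CARD('n)) * (\<Phi> w (half_map u w) * ?k (w - half_map u w) *
            (indicator ?H w * indicator ?H (half_map u w))) \<partial>lborel)"
        by (intro nn_integral_cmult[symmetric]) measurable
      also have "\<dots> = (\<integral>\<^sup>+u. \<Phi> w (half_map u w) * ennreal (last_coord w powr (- q)) *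
          ?k (u - last_axis) * (indicator ?H w * indicator ?H u) \<partial>lborel)"
      proof (rule nn_integral_cong)
        fix u :: "real ^ 'n::_"
        have "y ^ CARD('n) * norm (w - half_map u w) powr (- (real CARD('n) + q)) =
            (y powr real CARD('n) * y powr (- (real CARD('n) + q))) *
              norm (u - last_axis) powr (- (real CARD('n) + q))"
          using y by (simp add: norm_diff_half_map y_def[symmetric] powr_mult powr_realpow)
        also have "y powr real CARD('n) * y powr (- (real CARD('n) + q)) = y powr (- q)"
          by (simp add: powr_add[symmetric])
        finally have "ennreal (y ^ CARD('n)) * ?k (w - half_map u w) = ennreal (y powr (- q)) * ?k (u - last_axis)"
          using y by (simp add: ennreal_mult[symmetric])
        then show "ennreal (y ^ CARD('n)) * (\<Phi> w (half_map u w) * ?k (w - half_map u w) *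
            (indicator ?H w * indicator ?H (half_map u w))) =
            \<Phi> w (half_map u w) * ennreal (last_coord w powr (- q)) *
            ?k (u - last_axis) * (indicator ?H w * indicator ?H u)"
          unfolding y_def[symmetric] indicator_half_space_half_map[OF True] by (rule regroup)
      qed
      finally show ?thesis .
    qed simp
  qed
  also have "\<dots> = (\<integral>\<^sup>+u. (\<integral>\<^sup>+w. \<Phi> w (half_map u w) * ennreal (last_coord w powr (- q)) *
      ?k (u - last_axis) * (indicator ?H w * indicator ?H u) \<partial>lborel) \<partial>lborel)"
    by (rule lborel_pair.Fubini') measurable
  also have "\<dots> = (\<integral>\<^sup>+u. (?k (u - last_axis) * indicator ?H u) *
      (\<integral>\<^sup>+w\<in>?H. \<Phi> w (half_map u w) * ennreal (last_coord w powr (- q)) \<partial>lborel) \<partial>lborel)"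
  proof (rule nn_integral_cong)
    fix u :: "real ^ 'n::_"
    have "(\<integral>\<^sup>+w. (?k (u - last_axis) * indicator ?H u) *
        (\<Phi> w (half_map u w) * ennreal (last_coord w powr (- q)) * indicator ?H w) \<partial>lborel) =
        (?k (u - last_axis) * indicator ?H u) *
      (\<integral>\<^sup>+w\<in>?H. \<Phi> w (half_map u w) * ennreal (last_coord w powr (- q)) \<partial>lborel)"
      by (intro nn_integral_cmult) measurable
    then show "(\<integral>\<^sup>+w. \<Phi> w (half_map u w) * ennreal (last_coord w powr (- q)) *
      ?k (u - last_axis) * (indicator ?H w * indicator ?H u) \<partial>lborel) =
        (?k (u - last_axis) * indicator ?H u) *
      (\<integral>\<^sup>+w\<in>?H. \<Phi> w (half_map u w) * ennreal (last_coord w powr (- q)) \<partial>lborel)"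
      by (simp only: mult_ac)
  qed
  finally show ?thesis
    by (simp only: mult_ac)
qed

text \<open>The determinant of \<open>w \<mapsto> half_map u w\<close> is the last coordinate \<open>r\<close> of \<open>u\<close>, and \<open>y\<close> is multiplied
  by \<open>r\<close>, which accounts for the factors \<open>r\<^sup>-\<^sup>1\<close> and \<open>r\<^sup>q\<close>.\<close>

lemma nn_integral_half_map:
  fixes \<psi> :: "real ^ 'n::{finite,linorder} \<Rightarrow> ennreal" and q :: real
  assumes u: "u \<in> half_space" and [measurable]: "\<psi> \<in> borel_measurable borel"
  shows "(\<integral>\<^sup>+w\<in>half_space. \<psi> (half_map u w) * ennreal (last_coord w powr (- q)) \<partial>lborel) =
    ennreal (last_coord u powr (q - 1)) *
    (\<integral>\<^sup>+w\<in>half_space. \<psi> w * ennreal (last_coord w powr (- q)) \<partial>lborel)"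
proof -
  let ?H = "half_space :: (real ^ 'n::_) set"
  let ?r = "last_coord u"
  let ?F = "\<lambda>w. \<psi> w * ennreal (last_coord w powr (- q)) * indicator ?H w"
  have r: "0 < ?r"
    using u by (simp add: half_space_def)
  have "(\<integral>\<^sup>+w. \<psi> (half_map u w) * ennreal (last_coord w powr (- q)) * indicator ?H w \<partial>lborel) =
      (\<integral>\<^sup>+w. ennreal (?r powr q) * ?F (half_map u w) \<partial>lborel)"
  proof (rule nn_integral_cong)
    fix w :: "real ^ 'n::_"
    have "w \<in> ?H \<Longrightarrow> ennreal (last_coord w powr (- q)) =
        ennreal (?r powr q) * ennreal ((?r * last_coord w) powr (- q))"
      using r by (simp add: half_space_def ennreal_mult[symmetric] powr_mult mult.assoc[symmetric]
          powr_add[symmetric])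
    moreover have "half_map u w \<in> ?H \<longleftrightarrow> w \<in> ?H"
      using r by (simp add: half_space_def zero_less_mult_iff)
    ultimately show "\<psi> (half_map u w) * ennreal (last_coord w powr (- q)) * indicator ?H w =
        ennreal (?r powr q) * ?F (half_map u w)"
      by (cases "w \<in> ?H") (simp_all add: mult_ac)
  qed
  also have "\<dots> = ennreal (?r powr q) * (\<integral>\<^sup>+w. ?F (half_map u w) \<partial>lborel)"
    by (intro nn_integral_cmult) measurable
  also have "(\<integral>\<^sup>+w. ?F (half_map u w) \<partial>lborel) = ennreal (1 / ?r) * (\<integral>\<^sup>+w. ?F w \<partial>lborel)"
    unfolding half_map_def last_coord_inner
    using r last_axis_Basis by (intro nn_integral_lborel_replace_axis) (auto simp: last_coord_inner[symmetric])
  also have "ennreal (?r powr q) * (ennreal (1 / ?r) * (\<integral>\<^sup>+w. ?F w \<partial>lborel)) =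
      (ennreal (?r powr q) * ennreal (1 / ?r)) * (\<integral>\<^sup>+w. ?F w \<partial>lborel)"
    by (simp only: mult.assoc)
  also have "ennreal (?r powr q) * ennreal (1 / ?r) = ennreal (?r powr (q - 1))"
    using r by (simp add: ennreal_mult[symmetric] powr_diff)
  finally show ?thesis .
qed

section \<open>The reverse triangle inequality\<close>

text \<open>Convexity of \<open>x\<^sup>p\<close> at the combination \<open>s + t = l (s / l) + (1 - l) (t / (1 - l))\<close>. With an
  optimal \<open>l\<close> it gives Minkowski's inequality; with \<open>l\<close> close to 1 the first term keeps a coefficient close
  to 1, at the price of a large coefficient of the second.\<close>

lemma powr_add_le_weighted:
  fixes s t l p :: real
  assumes "0 \<le> s" "0 \<le> t" and l: "0 < l" "l < 1" and p: "1 \<le> p"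
  shows "(s + t) powr p \<le> l powr (1 - p) * s powr p + (1 - l) powr (1 - p) * t powr p"
proof (cases "s = 0 \<or> t = 0")
  case True
  have one: "1 \<le> m powr (1 - p)" if "0 < m" "m < 1" for m
    using that p powr_mono'[of "1 - p" 0 m] by simp
  show ?thesis
    using True mult_right_mono[OF one[OF l], of "s powr p"]
      mult_right_mono[OF one[of "1 - l"], of "t powr p"] l p by auto
next
  case False
  have scale: "m * (x / m) powr p = m powr (1 - p) * x powr p" if "0 < m" "0 < x" for m x
    using that by (simp add: powr_divide powr_diff)
  have "(l *\<^sub>R (s / l) + (1 - l) *\<^sub>R (t / (1 - l))) powr p \<le>
      l * (s / l) powr p + (1 - l) * (t / (1 - l)) powr p"
    using convex_onD[OF powr_convex[OF p], of "1 - l" "s / l" "t / (1 - l)"] False assms by simp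
  then show ?thesis
    using False assms by (simp add: scale)
qed

text \<open>The bound is attained for \<open>g = R f\<close>, where \<open>f - g\<close> and \<open>g\<close> are in the proportion \<open>1 - R\<close> to \<open>R\<close>; this
  dictates \<open>l = 1 - R\<close> in the weighted inequality.\<close>

lemma reverse_triangle_contracted:
  fixes f g :: "'a \<Rightarrow> 'b::{second_countable_topology, real_normed_vector}" and A R p :: real
  assumes [measurable]: "f \<in> borel_measurable M" "g \<in> borel_measurable M"
    and p: "1 \<le> p" and A: "0 \<le> A" and R: "0 < R" "R < 1"
    and f: "(\<integral>\<^sup>+x. ennreal (norm (f x) powr p) \<partial>M) = ennreal A"
    and g: "(\<integral>\<^sup>+x. ennreal (norm (g x) powr p) \<partial>M) = ennreal (R powr p * A)"
  shows "ennreal ((1 - R) powr p * A) \<le> (\<integral>\<^sup>+x. ennreal (norm (f x - g x) powr p) \<partial>M)"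
    (is "_ \<le> ?X")
proof (cases ?X)
  case (real X)
  have "ennreal A \<le> (\<integral>\<^sup>+x. ennreal ((1 - R) powr (1 - p)) * ennreal (norm (f x - g x) powr p) +
      ennreal (R powr (1 - p)) * ennreal (norm (g x) powr p) \<partial>M)"
    unfolding f[symmetric]
  proof (rule nn_integral_mono)
    fix x
    have "norm (f x) powr p \<le> (norm (f x - g x) + norm (g x)) powr p"
      using p norm_triangle_ineq[of "f x - g x" "g x"] by (intro powr_mono2) auto
    also have "\<dots> \<le> (1 - R) powr (1 - p) * norm (f x - g x) powr p + R powr (1 - p) * norm (g x) powr p"
      using powr_add_le_weighted[of "norm (f x - g x)" "norm (g x)" "1 - R" p] R p by simp
    finally show "ennreal (norm (f x) powr p) \<le> ennreal ((1 - R) powr (1 - p)) * ennreal (norm (f x - g x) powr p) +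
        ennreal (R powr (1 - p)) * ennreal (norm (g x) powr p)"
      by (simp add: ennreal_mult[symmetric] ennreal_plus[symmetric] del: ennreal_plus)
  qed
  also have "\<dots> = ennreal ((1 - R) powr (1 - p)) * ?X +
      ennreal (R powr (1 - p)) * (\<integral>\<^sup>+x. ennreal (norm (g x) powr p) \<partial>M)"
    by (subst nn_integral_add) (simp_all add: nn_integral_cmult)
  also have "\<dots> = ennreal ((1 - R) powr (1 - p) * X + R powr (1 - p) * (R powr p * A))"
    unfolding g using real A by (simp add: ennreal_mult)
  finally have "A \<le> (1 - R) powr (1 - p) * X + R powr (1 - p) * (R powr p * A)"
    using real A by (subst (asm) ennreal_le_iff) auto
  also have "R powr (1 - p) * (R powr p * A) = R * A"
    using R by (simp add: powr_diff)
  finally have "(1 - R) * A \<le> (1 - R) powr (1 - p) * X"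
    by (simp add: algebra_simps)
  then have "(1 - R) powr (p - 1) * ((1 - R) * A) \<le> (1 - R) powr (p - 1) * ((1 - R) powr (1 - p) * X)"
    by (intro mult_left_mono) auto
  then have "(1 - R) powr p * A \<le> X"
    using R by (simp add: mult.assoc[symmetric] powr_add[symmetric] powr_mult_base' powr_diff)
  then show ?thesis
    using real by (simp add: ennreal_leI)
qed (simp)

text \<open>For \<open>R > 1\<close> the roles of \<open>f\<close> and \<open>g\<close> are exchanged and the ratio is \<open>1 / R\<close>.\<close>

lemma reverse_triangle_dilated:
  fixes f g :: "'a \<Rightarrow> 'b::{second_countable_topology, real_normed_vector}" and R p :: real
  assumes [measurable]: "f \<in> borel_measurable M" "g \<in> borel_measurable M"
    and p: "1 \<le> p" and R: "0 < R"
    and fin: "(\<integral>\<^sup>+x. ennreal (norm (f x) powr p) \<partial>M) < \<infinity>"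
    and g: "(\<integral>\<^sup>+x. ennreal (norm (g x) powr p) \<partial>M) =
      ennreal (R powr p) * (\<integral>\<^sup>+x. ennreal (norm (f x) powr p) \<partial>M)"
  shows "ennreal (\<bar>1 - R\<bar> powr p) * (\<integral>\<^sup>+x. ennreal (norm (f x) powr p) \<partial>M) \<le>
    (\<integral>\<^sup>+x. ennreal (norm (f x - g x) powr p) \<partial>M)"
proof -
  obtain A where A: "0 \<le> A" "(\<integral>\<^sup>+x. ennreal (norm (f x) powr p) \<partial>M) = ennreal A"
    using fin by (cases "\<integral>\<^sup>+x. ennreal (norm (f x) powr p) \<partial>M") auto
  have gA: "(\<integral>\<^sup>+x. ennreal (norm (g x) powr p) \<partial>M) = ennreal (R powr p * A)"
    using g A by (simp add: ennreal_mult)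
  consider "R < 1" | "R = 1" | "1 < R" by linarith
  then show ?thesis
  proof cases
    case 1
    show ?thesis
      using reverse_triangle_contracted[OF assms(1,2) p A(1) R 1 A(2) gA] 1 A
      by (simp add: ennreal_mult)
  next
    case 2
    then show ?thesis by simp
  next
    case 3
    have "(1 / R) powr p * (R powr p * A) = A"
      using R by (simp add: powr_divide)
    then have "ennreal ((1 - 1 / R) powr p * (R powr p * A)) \<le> (\<integral>\<^sup>+x. ennreal (norm (g x - f x) powr p) \<partial>M)"
      using A 3 by (intro reverse_triangle_contracted[OF assms(2,1) p]) (simp_all add: gA)
    also have "(1 - 1 / R) powr p * (R powr p * A) = \<bar>1 - R\<bar> powr p * A"
    proof -
      have "\<bar>1 - R\<bar> = (1 - 1 / R) * R"
        using 3 by (simp add: field_simps)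
      then show ?thesis
        using 3 by (simp add: powr_mult)
    qed
    finally show ?thesis
      using A by (simp add: ennreal_mult norm_minus_commute)
  qed
qed


section \<open>The inequality\<close>

text \<open>The constant in the form in which it comes out of the substitution: the cost of comparing the
  virtual extremal \<open>y\<^sup>a\<close> at the point \<open>last_axis\<close> with its values at all other points. It is defined
  in \<open>[0, \<infinity>]\<close>, since its finiteness is only known later.\<close>

definition ground_state_integral :: "'n::{finite,linorder} itself \<Rightarrow> real \<Rightarrow> real \<Rightarrow> ennreal"
  where "ground_state_integral _ p \<beta> =
    (\<integral>\<^sup>+u\<in>half_space. ennreal (norm (u - last_axis :: real ^ 'n::_) powr (- (real CARD('n::_) + p * \<beta>))) *
      ennreal (\<bar>1 - last_coord u powr (\<beta> - 1 / p)\<bar> powr p) \<partial>lborel)"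

lemma gagliardo_integral_half_map:
  fixes f :: "real ^ 'n::{finite,linorder} \<Rightarrow> complex"
  assumes [measurable]: "f \<in> borel_measurable borel"
  shows "gagliardo_integral p \<beta> f =
    (\<integral>\<^sup>+u\<in>half_space. ennreal (norm (u - last_axis) powr (- (real CARD('n::_) + p * \<beta>))) *
      (\<integral>\<^sup>+w\<in>half_space. ennreal (norm (f w - f (half_map u w)) powr p) *
        ennreal (last_coord w powr (- (p * \<beta>))) \<partial>lborel) \<partial>lborel)"
proof -
  have *: "(\<lambda>(w, w'). ennreal (norm (f w - f w') powr p)) \<in> borel_measurable borel"
    unfolding borel_prod[symmetric] by measurable
  have "ennreal (norm (f w - f w') powr p / norm (w - w') powr (real CARD('n::_) + p * \<beta>)) =
      ennreal (norm (f w - f w') powr p) * ennreal (norm (w - w') powr (- (real CARD('n::_) + p * \<beta>)))" for w w'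
    by (simp only: powr_minus divide_inverse ennreal_mult powr_ge_zero inverse_nonnegative_iff_nonnegative)
  then show ?thesis
    unfolding gagliardo_integral_def using half_space_pairs_substitution[OF *, of "p * \<beta>"] by simp
qed

lemma hardy_integral_alt:
  "hardy_integral p \<beta> f = (\<integral>\<^sup>+w\<in>half_space. ennreal (norm (f w) powr p) *
    ennreal (last_coord w powr (- (p * \<beta>))) \<partial>lborel)"
  by (simp add: hardy_integral_def ennreal_mult)

lemma ground_state_integral_le_gagliardo:
  fixes f :: "real ^ 'n::{finite,linorder} \<Rightarrow> complex"
  assumes [measurable]: "f \<in> borel_measurable borel" and p: "1 \<le> p" and fin: "hardy_integral p \<beta> f < \<infinity>"
  shows "ground_state_integral TYPE('n::_) p \<beta> * hardy_integral p \<beta> f \<le> gagliardo_integral p \<beta> f"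
proof -
  define q where "q = p * \<beta>"
  define a where "a = \<beta> - 1 / p"
  have qa: "q - 1 = a * p"
    using p by (simp add: q_def a_def field_simps)
  define M where "M = density lborel (\<lambda>w::real ^ 'n::_. ennreal (last_coord w powr (- q)) * indicator half_space w)"
  have M: "(\<integral>\<^sup>+w. h w \<partial>M) = (\<integral>\<^sup>+w\<in>half_space. h w * ennreal (last_coord w powr (- q)) \<partial>lborel)"
    if [measurable]: "h \<in> borel_measurable borel" for h
    unfolding M_def by (subst nn_integral_density) (auto simp: mult_ac)
  have hardy: "hardy_integral p \<beta> f = (\<integral>\<^sup>+w. ennreal (norm (f w) powr p) \<partial>M)"
    by (simp add: hardy_integral_alt M q_def)
  have inner: "ennreal (\<bar>1 - last_coord u powr a\<bar> powr p) * hardy_integral p \<beta> f \<le>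
      (\<integral>\<^sup>+w\<in>half_space. ennreal (norm (f w - f (half_map u w)) powr p) *
        ennreal (last_coord w powr (- q)) \<partial>lborel)" if u: "u \<in> half_space" for u
  proof -
    have r: "0 < last_coord u"
      using u by (simp add: half_space_def)
    have "(\<integral>\<^sup>+w. ennreal (norm (f (half_map u w)) powr p) \<partial>M) =
        ennreal (last_coord u powr (q - 1)) * hardy_integral p \<beta> f"
      using nn_integral_half_map[OF u, of "\<lambda>w. ennreal (norm (f w) powr p)" q]
      by (simp add: M hardy_integral_alt q_def)
    then have "(\<integral>\<^sup>+w. ennreal (norm (f (half_map u w)) powr p) \<partial>M) =
        ennreal ((last_coord u powr a) powr p) * (\<integral>\<^sup>+w. ennreal (norm (f w) powr p) \<partial>M)"
      using r by (simp add: qa powr_powr hardy)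
    then have "ennreal (\<bar>1 - last_coord u powr a\<bar> powr p) * (\<integral>\<^sup>+w. ennreal (norm (f w) powr p) \<partial>M) \<le>
        (\<integral>\<^sup>+w. ennreal (norm (f w - f (half_map u w)) powr p) \<partial>M)"
      using r p fin by (intro reverse_triangle_dilated) (auto simp: M_def hardy)
    then show ?thesis
      by (simp add: hardy M)
  qed
  have "ground_state_integral TYPE('n::_) p \<beta> * hardy_integral p \<beta> f =
      (\<integral>\<^sup>+u\<in>half_space. ennreal (norm (u - last_axis :: real ^ 'n::_) powr (- (real CARD('n::_) + q))) *
      (ennreal (\<bar>1 - last_coord u powr a\<bar> powr p) * hardy_integral p \<beta> f) \<partial>lborel)"
    unfolding ground_state_integral_def q_def a_def
    by (subst nn_integral_multc[symmetric]) (auto intro!: nn_integral_cong simp: mult_ac)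
  also have "\<dots> \<le> gagliardo_integral p \<beta> f"
    unfolding gagliardo_integral_half_map[OF assms(1)] q_def[symmetric]
    by (intro nn_integral_mono) (auto split: split_indicator intro!: mult_left_mono inner)
  finally show ?thesis .
qed

lemma ground_state_integral_slice:
  assumes p: "0 < p" and \<beta>: "0 < \<beta>"
  defines "n \<equiv> real CARD('n::{finite,linorder})"
  shows "ground_state_integral TYPE('n::_) p \<beta> =
    ennreal (pi powr ((n - 1) / 2) * Gamma ((p * \<beta> + 1) / 2) / Gamma ((p * \<beta> + n) / 2)) *
    (\<integral>\<^sup>+y\<in>{0<..}. ennreal (\<bar>1 - y powr (\<beta> - 1 / p)\<bar> powr p * \<bar>y - 1\<bar> powr (- 1 - p * \<beta>)) \<partial>lborel)"
proof -
  define g where "g = (\<lambda>s::real. ennreal (\<bar>1 - (1 + s) powr (\<beta> - 1 / p)\<bar> powr p) * indicator {0<..} (1 + s))"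
  have [measurable]: "g \<in> borel_measurable borel"
    unfolding g_def by measurable
  have q: "-1 < p * \<beta>"
    using mult_pos_pos[OF p \<beta>] by linarith
  have "ground_state_integral TYPE('n::_) p \<beta> =
      (\<integral>\<^sup>+v. g (v $ Max UNIV) * ennreal (norm v powr (- (n + p * \<beta>))) \<partial>(lborel :: (real ^ 'n::_) measure))"
    unfolding ground_state_integral_def
    by (subst nn_integral_lborel_affine[of 1 _ last_axis])
      (auto intro!: nn_integral_cong simp: g_def n_def half_space_def last_coord_def indicator_def mult_ac)
  also have "\<dots> = ennreal (pi powr ((n - 1) / 2) * Gamma ((p * \<beta> + 1) / 2) / Gamma ((p * \<beta> + n) / 2)) *
      (\<integral>\<^sup>+s. g s * ennreal (\<bar>s\<bar> powr (- (1 + p * \<beta>))) \<partial>lborel)"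
    unfolding n_def using q by (rule nn_integral_kernel_slice) measurable
  also have "(\<integral>\<^sup>+s. g s * ennreal (\<bar>s\<bar> powr (- (1 + p * \<beta>))) \<partial>lborel) =
      (\<integral>\<^sup>+y\<in>{0<..}. ennreal (\<bar>1 - y powr (\<beta> - 1 / p)\<bar> powr p * \<bar>y - 1\<bar> powr (- 1 - p * \<beta>)) \<partial>lborel)"
    by (subst (2) nn_integral_real_affine[of _ 1 1])
      (auto intro!: nn_integral_cong simp: g_def ennreal_mult mult_ac)
  finally show ?thesis .
qed

text \<open>Both sides are 0 if the one-dimensional integral diverges.\<close>

lemma hardy_const_eq_ground_state_integral:
  assumes p: "0 < p" and \<beta>: "0 < \<beta>"
  shows "hardy_const CARD('n::{finite,linorder}) p \<beta> = enn2real (ground_state_integral TYPE('n::_) p \<beta>)"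
proof -
  define n where "n = real CARD('n::_)"
  have "1 \<le> n"
    unfolding n_def using card_gt_0_iff[of "UNIV :: 'n::_ set"] by simp
  then have c: "0 \<le> pi powr ((n - 1) / 2) * Gamma ((p * \<beta> + 1) / 2) / Gamma ((p * \<beta> + n) / 2)"
    using mult_pos_pos[OF p \<beta>] by (auto intro!: mult_nonneg_nonneg divide_nonneg_pos Gamma_real_pos less_imp_le)
  have "(LBINT y:{0<..}. \<bar>1 - y powr (\<beta> - 1 / p)\<bar> powr p * \<bar>y - 1\<bar> powr (- 1 - p * \<beta>)) =
      enn2real (\<integral>\<^sup>+y\<in>{0<..}. ennreal (\<bar>1 - y powr (\<beta> - 1 / p)\<bar> powr p * \<bar>y - 1\<bar> powr (- 1 - p * \<beta>)) \<partial>lborel)"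
    unfolding set_lebesgue_integral_def
    by (subst integral_eq_nn_integral) (auto intro!: arg_cong[where f = enn2real] nn_integral_cong simp: indicator_def)
  then show ?thesis
    unfolding hardy_const_def ground_state_integral_slice[OF p \<beta>, where 'n = 'n] n_def[symmetric]
    using c by (simp add: enn2real_mult)
qed


section \<open>Finiteness\<close>

text \<open>A product majorant, so that integrals against it factor into integrals over the line.\<close>

definition decay :: "real ^ 'n::finite \<Rightarrow> real"
  where "decay w = (\<Prod>i\<in>UNIV. 1 / (1 + (w $ i)\<^sup>2))"

lemma inverse_1_plus_square: "0 < 1 / (1 + (s::real)\<^sup>2)" "1 / (1 + (s::real)\<^sup>2) \<le> 1"
  by (simp_all add: divide_le_eq_1 add_pos_nonneg)

lemma decay_pos: "0 < decay w" and decay_le_1: "decay w \<le> 1"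
  unfolding decay_def using inverse_1_plus_square
  by (auto intro!: prod_pos prod_le_1 intro: less_imp_le)

lemma decay_measurable [measurable]: "decay \<in> borel_measurable borel"
  unfolding decay_def[abs_def] by measurable

lemma nn_integral_powr_0_1:
  assumes "-1 < (c::real)"
  shows "(\<integral>\<^sup>+s\<in>{0<..1}. ennreal (s powr c) \<partial>lborel) < \<infinity>"
proof -
  have "(\<integral>\<^sup>+s. ennreal (indicator {0..1} s * s powr c) \<partial>lborel) = ennreal (1 powr (c + 1) / (c + 1))"
    using nn_integral_has_integral_lebesgue[OF _ has_integral_powr_from_0[OF assms, of 1]] by simp
  moreover have "(\<integral>\<^sup>+s\<in>{0<..1}. ennreal (s powr c) \<partial>lborel) \<le>
      (\<integral>\<^sup>+s. ennreal (indicator {0..1} s * s powr c) \<partial>lborel)"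
    by (intro nn_integral_mono) (auto split: split_indicator)
  ultimately show ?thesis
    using le_less_trans ennreal_less_top by fastforce
qed

lemma nn_integral_powr_1_inf:
  assumes "c < -1"
  shows "(\<integral>\<^sup>+s\<in>{1..}. ennreal (s powr c) \<partial>lborel) < \<infinity>"
proof -
  have "(\<integral>\<^sup>+s. ennreal (indicator {1..} s * s powr c) \<partial>lborel) = ennreal (- (1 powr (c + 1)) / (c + 1))"
    using nn_integral_has_integral_lebesgue[OF _ has_integral_powr_to_inf[OF assms, of 1]] by simp
  moreover have "(\<integral>\<^sup>+s\<in>{1..}. ennreal (s powr c) \<partial>lborel) =
      (\<integral>\<^sup>+s. ennreal (indicator {1..} s * s powr c) \<partial>lborel)"
    by (intro nn_integral_cong) (auto split: split_indicator)
  ultimately show ?thesis by simp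
qed

lemma nn_integral_even_extension:
  fixes h :: "real \<Rightarrow> ennreal"
  assumes [measurable]: "h \<in> borel_measurable borel"
  shows "(\<integral>\<^sup>+s. h \<bar>s\<bar> \<partial>lborel) = 2 * (\<integral>\<^sup>+s\<in>{0<..}. h s \<partial>lborel)"
proof -
  have "(\<integral>\<^sup>+s. h \<bar>s\<bar> \<partial>lborel) = (\<integral>\<^sup>+s. h s * indicator {0<..} s + h (- s) * indicator {0<..} (- s) \<partial>lborel)"
  proof (rule nn_integral_cong_AE)
    show "AE s in lborel. h \<bar>s\<bar> = h s * indicator {0<..} s + h (- s) * indicator {0<..} (- s)"
      using AE_lborel_singleton[of "0::real"] by eventually_elim (auto simp: indicator_def)
  qed
  also have "\<dots> = (\<integral>\<^sup>+s\<in>{0<..}. h s \<partial>lborel) + (\<integral>\<^sup>+s. h (- s) * indicator {0<..} (- s) \<partial>lborel)"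
    by (intro nn_integral_add) measurable
  also have "(\<integral>\<^sup>+s. h (- s) * indicator {0<..} (- s) \<partial>lborel) = (\<integral>\<^sup>+s\<in>{0<..}. h s \<partial>lborel)"
    using nn_integral_real_affine[of "\<lambda>s. h s * indicator {0<..} s" "-1" 0] by simp
  finally show ?thesis
    by (simp add: mult_2)
qed

lemma nn_integral_inverse_1_plus_square: "(\<integral>\<^sup>+s. ennreal (1 / (1 + s\<^sup>2)) \<partial>lborel) < \<infinity>"
proof -
  have eq: "(\<integral>\<^sup>+s. ennreal (1 / (1 + s\<^sup>2)) \<partial>lborel) = 2 * (\<integral>\<^sup>+s\<in>{0<..}. ennreal (1 / (1 + s\<^sup>2)) \<partial>lborel)"
    using nn_integral_even_extension[of "\<lambda>s. ennreal (1 / (1 + s\<^sup>2))"] by simp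
  have "(\<integral>\<^sup>+s\<in>{0<..}. ennreal (1 / (1 + s\<^sup>2)) \<partial>lborel) \<le>
      (\<integral>\<^sup>+s. ennreal (s powr 0) * indicator {0<..1} s + ennreal (s powr (-2)) * indicator {1..} s \<partial>lborel)"
  proof (rule nn_integral_mono)
    fix s :: real
    consider "s \<le> 0" | "0 < s" "s \<le> 1" | "1 < s" by linarith
    then show "ennreal (1 / (1 + s\<^sup>2)) * indicator {0<..} s \<le>
        ennreal (s powr 0) * indicator {0<..1} s + ennreal (s powr (-2)) * indicator {1..} s"
    proof cases
      case 2
      then show ?thesis
        using inverse_1_plus_square(2)[of s] by (simp add: add_increasing2)
    next
      case 3
      then have "1 / (1 + s\<^sup>2) \<le> s powr (-2)"
        by (simp add: powr_minus powr_numeral field_simps add_pos_nonneg)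
      then show ?thesis
        using 3 by (simp add: ennreal_leI)
    qed simp
  qed
  also have "\<dots> = (\<integral>\<^sup>+s\<in>{0<..1}. ennreal (s powr 0) \<partial>lborel) + (\<integral>\<^sup>+s\<in>{1..}. ennreal (s powr (-2)) \<partial>lborel)"
    by (intro nn_integral_add) measurable
  also have "\<dots> < \<infinity>"
    using nn_integral_powr_0_1[of 0] nn_integral_powr_1_inf[of "-2"] by simp
  finally have "(\<integral>\<^sup>+s\<in>{0<..}. ennreal (1 / (1 + s\<^sup>2)) \<partial>lborel) < \<infinity>" .
  then show ?thesis
    by (simp add: eq ennreal_mult_less_top)
qed

text \<open>The last coordinate contributes an integral of \<open>s\<^sup>c / (1 + (s + z)\<^sup>2)\<close> over the half-line. The
  power is integrable up to 1 and bounded by 1 beyond, which removes the dependence on the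
  translation \<open>z\<close>.\<close>

lemma uniform_decay_bound:
  fixes c :: real
  assumes c: "-1 < c" "c \<le> 0"
  shows "\<exists>M<\<infinity>. \<forall>z :: real ^ 'n::{finite,linorder}.
    (\<integral>\<^sup>+w\<in>half_space. ennreal (last_coord w powr c) * ennreal (decay (w + z)) \<partial>lborel) \<le> M"
proof -
  let ?b = "\<lambda>s::real. ennreal (1 / (1 + s\<^sup>2))"
  define K where "K = (\<integral>\<^sup>+s. ?b s \<partial>lborel) + (\<integral>\<^sup>+s\<in>{0<..1}. ennreal (s powr c) \<partial>lborel)"
  have K: "K < \<infinity>"
    using nn_integral_inverse_1_plus_square nn_integral_powr_0_1[OF c(1)] by (simp add: K_def)
  have shift: "(\<integral>\<^sup>+s. ?b (s + x) \<partial>lborel) = (\<integral>\<^sup>+s. ?b s \<partial>lborel)" for x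
    using nn_integral_real_affine[of ?b 1 x] by (simp add: add.commute)
  have "(\<integral>\<^sup>+w\<in>half_space. ennreal (last_coord w powr c) * ennreal (decay (w + z)) \<partial>lborel) \<le> K ^ CARD('n)"
    for z :: "real ^ 'n::_"
  proof -
    define F where "F = (\<lambda>i s. (if i = Max UNIV then ennreal (s powr c) * indicator {0<..} s else 1) * ?b (s + z $ i))"
    have [measurable]: "F i \<in> borel_measurable borel" for i
      unfolding F_def by measurable
    have "ennreal (last_coord w powr c) * ennreal (decay (w + z)) * indicator half_space w =
        (\<Prod>i\<in>UNIV. F i (w $ i))" for w
    proof -
      have "ennreal (decay (w + z)) = (\<Prod>i\<in>UNIV. ?b (w $ i + z $ i))"
        unfolding decay_def by (subst prod_ennreal) auto
      then show ?thesis
        by (simp add: F_def prod.distrib prod.delta last_coord_def half_space_def indicator_def)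
    qed
    then have "(\<integral>\<^sup>+w\<in>half_space. ennreal (last_coord w powr c) * ennreal (decay (w + z)) \<partial>lborel) =
        (\<Prod>i\<in>UNIV. \<integral>\<^sup>+s. F i s \<partial>lborel)"
      by (simp add: nn_integral_lborel_coordinates)
    also have "\<dots> \<le> (\<Prod>i\<in>(UNIV :: 'n set). K)"
    proof (rule prod_mono_ennreal)
      fix i :: 'n
      assume "i \<in> UNIV"
      have "(\<integral>\<^sup>+s. F i s \<partial>lborel) \<le>
          (\<integral>\<^sup>+s. ?b (s + z $ i) + ennreal (s powr c) * indicator {0<..1} s \<partial>lborel)"
      proof (rule nn_integral_mono)
        fix s :: real
        have b1: "?b (s + z $ i) \<le> 1"
          using inverse_1_plus_square(2) by simp
        show "F i s \<le> ?b (s + z $ i) + ennreal (s powr c) * indicator {0<..1} s"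
        proof (cases "i = Max UNIV")
          case True
          consider "s \<le> 0" | "0 < s" "s \<le> 1" | "1 < s" by linarith
          then show ?thesis
          proof cases
            case 2
            then have "F i s \<le> ennreal (s powr c) * 1"
              using True mult_left_mono[OF b1, of "ennreal (s powr c)"] by (simp add: F_def)
            then show ?thesis
              using 2 by (simp add: add_increasing)
          next
            case 3
            then have "s powr c \<le> 1"
              using c powr_mono[of c 0 s] by simp
            then have "ennreal (s powr c) \<le> 1"
              by simp
            from mult_right_mono[OF this, of "?b (s + z $ i)"] have "F i s \<le> 1 * ?b (s + z $ i)"
              using 3 True by (simp add: F_def)
            then show ?thesis
              using 3 by simp
          qed (simp add: F_def True)
        qed (simp add: F_def)
      qed
      also have "\<dots> = K"
        by (subst nn_integral_add) (simp_all add: K_def shift)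
      finally show "(\<integral>\<^sup>+s. F i s \<partial>lborel) \<le> K" .
    qed
    finally show ?thesis by simp
  qed
  moreover have "K ^ CARD('n) < \<infinity>"
    using K by (simp add: power_less_top_ennreal)
  ultimately show ?thesis by blast
qed

text \<open>The largest coordinate of \<open>v\<close> is at least \<open>|v| / n\<close>, so the truncation of \<open>|v|\<close> may be replaced
  by truncations of single coordinates, to which the slicing of the kernel applies.\<close>

lemma truncated_kernel_finite:
  assumes q: "0 < q" "q < p"
  shows "(\<integral>\<^sup>+v. ennreal (min 1 (norm v) powr p * norm v powr (- (real CARD('n) + q)))
    \<partial>(lborel :: (real ^ 'n::finite) measure)) < \<infinity>"
proof -
  define N where "N = real CARD('n)"
  have N: "1 \<le> N"
    unfolding N_def using card_gt_0_iff[of "UNIV :: 'n set"] by simp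
  define g where "g = (\<lambda>s::real. ennreal (min 1 \<bar>s\<bar> powr p))"
  have [measurable]: "g \<in> borel_measurable borel"
    unfolding g_def by measurable
  let ?I = "\<integral>\<^sup>+s. g s * ennreal (\<bar>s\<bar> powr (- (1 + q))) \<partial>lborel"
  have eq: "?I = 2 * (\<integral>\<^sup>+s\<in>{0<..}. ennreal (min 1 s powr p * s powr (- (1 + q))) \<partial>lborel)"
    using nn_integral_even_extension[of "\<lambda>s. ennreal (min 1 s powr p * s powr (- (1 + q)))"] by (simp add: g_def ennreal_mult)
  have "(\<integral>\<^sup>+s\<in>{0<..}. ennreal (min 1 s powr p * s powr (- (1 + q))) \<partial>lborel) \<le>
      (\<integral>\<^sup>+s. ennreal (s powr (p - (1 + q))) * indicator {0<..1} s + ennreal (s powr (- (1 + q))) * indicator {1..} s \<partial>lborel)"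
    by (intro nn_integral_mono) (auto split: split_indicator simp: powr_add[symmetric] min_def algebra_simps)
  also have "\<dots> = (\<integral>\<^sup>+s\<in>{0<..1}. ennreal (s powr (p - (1 + q))) \<partial>lborel) +
      (\<integral>\<^sup>+s\<in>{1..}. ennreal (s powr (- (1 + q))) \<partial>lborel)"
    by (intro nn_integral_add) measurable
  also have "\<dots> < \<infinity>"
    using nn_integral_powr_0_1[of "p - (1 + q)"] nn_integral_powr_1_inf[of "- (1 + q)"] q by simp
  finally have "(\<integral>\<^sup>+s\<in>{0<..}. ennreal (min 1 s powr p * s powr (- (1 + q))) \<partial>lborel) < \<infinity>" .
  then have I: "?I < \<infinity>"
    unfolding eq by (simp add: ennreal_mult_less_top)
  have "(\<integral>\<^sup>+v. ennreal (min 1 (norm v) powr p * norm v powr (- (N + q))) \<partial>(lborel :: (real ^ 'n) measure)) \<le>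
      (\<integral>\<^sup>+v. (\<Sum>i\<in>UNIV. ennreal (N powr p) * (g (v $ i) * ennreal (norm v powr (- (N + q))))) \<partial>(lborel :: (real ^ 'n) measure))"
  proof (rule nn_integral_mono)
    fix v :: "real ^ 'n"
    have "\<exists>i. norm v \<le> N * \<bar>v $ i\<bar>"
    proof (rule ccontr)
      assume "\<nexists>i. norm v \<le> N * \<bar>v $ i\<bar>"
      then have "\<bar>v $ i\<bar> < norm v / N" for i
        using N by (auto simp: not_le field_simps)
      then have "(\<Sum>i\<in>UNIV. \<bar>v $ i\<bar>) < (\<Sum>i\<in>(UNIV :: 'n set). norm v / N)"
        by (intro sum_strict_mono) auto
      also have "\<dots> = norm v"
        using N by (simp add: N_def)
      finally show False
        using norm_le_l1_cart[of v] by simp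
    qed
    then obtain i where i: "norm v \<le> N * \<bar>v $ i\<bar>" by blast
    have "min 1 (norm v) \<le> N * min 1 \<bar>v $ i\<bar>"
      using i N by (auto simp: min_def)
    then have "min 1 (norm v) powr p \<le> (N * min 1 \<bar>v $ i\<bar>) powr p"
      using q by (intro powr_mono2) auto
    then have "min 1 (norm v) powr p * norm v powr (- (N + q)) \<le>
        N powr p * (min 1 \<bar>v $ i\<bar> powr p * norm v powr (- (N + q)))"
      using N by (simp add: powr_mult mult.assoc[symmetric] mult_right_mono)
    then have "ennreal (min 1 (norm v) powr p * norm v powr (- (N + q))) \<le>
        ennreal (N powr p) * (g (v $ i) * ennreal (norm v powr (- (N + q))))"
      unfolding g_def by (simp add: ennreal_mult[symmetric] ennreal_leI)
    also have "\<dots> \<le> (\<Sum>i\<in>UNIV. ennreal (N powr p) * (g (v $ i) * ennreal (norm v powr (- (N + q)))))"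
      by (intro member_le_sum) auto
    finally show "ennreal (min 1 (norm v) powr p * norm v powr (- (N + q))) \<le>
        (\<Sum>i\<in>UNIV. ennreal (N powr p) * (g (v $ i) * ennreal (norm v powr (- (N + q)))))" .
  qed
  also have "\<dots> = (\<Sum>i\<in>UNIV. ennreal (N powr p) *
      (\<integral>\<^sup>+v. g (v $ i) * ennreal (norm v powr (- (N + q))) \<partial>(lborel :: (real ^ 'n) measure)))"
    by (simp add: nn_integral_sum nn_integral_cmult)
  also have "\<dots> = (\<Sum>i\<in>(UNIV :: 'n set). ennreal (N powr p) * (ennreal (pi powr ((N - 1) / 2) * Gamma ((q + 1) / 2) / Gamma ((q + N) / 2)) * ?I))"
    using q unfolding N_def by (subst nn_integral_kernel_slice) simp_all
  also have "\<dots> < \<infinity>"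
    using I by (simp add: ennreal_mult_less_top ennreal_of_nat_eq_real_of_nat)
  finally show ?thesis
    by (simp add: N_def)
qed


lemma hardy_integral_finite:
  fixes f :: "real ^ 'n::{finite,linorder} \<Rightarrow> complex"
  assumes p: "1 \<le> p" and \<beta>: "0 < \<beta>" "p * \<beta> < 1"
    and f: "\<And>w. norm (f w) \<le> C * decay w"
  shows "hardy_integral p \<beta> f < \<infinity>"
proof -
  have C: "0 \<le> C"
    using order_trans[OF norm_ge_zero f[of 0]] decay_pos[of "0 :: real ^ 'n::_"] by (simp add: zero_le_mult_iff)
  obtain M where M: "M < \<infinity>" "\<And>z :: real ^ 'n::_.
      (\<integral>\<^sup>+w\<in>half_space. ennreal (last_coord w powr (- (p * \<beta>))) * ennreal (decay (w + z)) \<partial>lborel) \<le> M"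
    using uniform_decay_bound[of "- (p * \<beta>)"] p \<beta> by (auto simp: less_imp_le)
  have "hardy_integral p \<beta> f \<le> (\<integral>\<^sup>+w. ennreal (C powr p) *
      (ennreal (last_coord (w :: real ^ 'n::_) powr (- (p * \<beta>))) * ennreal (decay w) * indicator half_space w) \<partial>lborel)"
    unfolding hardy_integral_alt
  proof (rule nn_integral_mono)
    fix w :: "real ^ 'n::_"
    have d: "0 < decay w" "decay w \<le> 1"
      using decay_pos decay_le_1 by auto
    have "norm (f w) powr p \<le> (C * decay w) powr p"
      using f p by (intro powr_mono2) auto
    also have "\<dots> = C powr p * decay w powr p"
      using d C by (simp add: powr_mult)
    also have "\<dots> \<le> C powr p * decay w"
      using d p powr_mono'[of 1 p "decay w"] by (intro mult_left_mono) auto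
    finally have *: "ennreal (norm (f w) powr p) \<le> ennreal (C powr p) * ennreal (decay w)"
      using d by (simp add: ennreal_mult[symmetric] ennreal_leI)
    show "ennreal (norm (f w) powr p) * ennreal (last_coord w powr (- (p * \<beta>))) * indicator half_space w \<le>
        ennreal (C powr p) * (ennreal (last_coord w powr (- (p * \<beta>))) * ennreal (decay w) * indicator half_space w)"
      using mult_right_mono[OF *, of "ennreal (last_coord w powr (- (p * \<beta>))) * indicator half_space w"]
      by (simp only: mult_ac zero_le)
  qed
  also have "\<dots> \<le> ennreal (C powr p) * M"
    using M(2)[of 0] by (subst nn_integral_cmult) (auto intro: mult_left_mono)
  also have "\<dots> < \<infinity>"
    using M(1) by (simp add: ennreal_mult_less_top)
  finally show ?thesis .
qed

lemma inverse_decay_le: "1 / decay w \<le> (1 + (norm w)\<^sup>2) ^ CARD('n)" for w :: "real ^ 'n::finite"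
proof -
  have "1 / decay w = (\<Prod>i\<in>UNIV. 1 + (w $ i)\<^sup>2)"
    unfolding decay_def by (simp add: prod_dividef)
  also have "\<dots> \<le> (\<Prod>i\<in>(UNIV :: 'n set). 1 + (norm w)\<^sup>2)"
    using component_le_norm_cart[of w] by (intro prod_mono) (auto simp: abs_le_square_iff[symmetric])
  finally show ?thesis by simp
qed

text \<open>Since \<open>1 / decay w\<close> is at most \<open>(1 + |w|\<^sup>2)\<^sup>n\<close>, boundedness of \<open>f\<close> and \<open>|w|\<^sup>2\<^sup>n f\<close> is enough.\<close>

lemma schwartz_decay:
  fixes f :: "real ^ 'n::finite \<Rightarrow> complex"
  assumes "schwartz f"
  obtains C where "\<And>w. norm (f w) \<le> C * decay w"
proof -
  let ?n = "CARD('n)"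
  have "bounded (range (\<lambda>x. norm x ^ k *\<^sub>R f x))" for k
    using assms unfolding schwartz_def iter_partial_def by (metis foldr_Nil id_apply)
  then obtain B where B: "\<And>k x. norm x ^ k * norm (f x) \<le> B k"
    unfolding bounded_iff by (auto simp: image_iff) metis
  have "norm (f w) \<le> (2 ^ ?n * (B 0 + B (2 * ?n))) * decay w" for w
  proof -
    have "(1 + (norm w)\<^sup>2) ^ ?n \<le> (2 * max 1 ((norm w)\<^sup>2)) ^ ?n"
      by (intro power_mono) auto
    also have "\<dots> = 2 ^ ?n * (max 1 ((norm w)\<^sup>2)) ^ ?n"
      by (rule power_mult_distrib)
    also have "(max 1 ((norm w)\<^sup>2)) ^ ?n \<le> norm w ^ 0 + norm w ^ (2 * ?n)"
      by (auto simp: max_def power_mult)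
    finally have "1 / decay w \<le> 2 ^ ?n * (norm w ^ 0 + norm w ^ (2 * ?n))"
      using inverse_decay_le[of w] by simp
    then have "1 / decay w * norm (f w) \<le> 2 ^ ?n * (norm w ^ 0 + norm w ^ (2 * ?n)) * norm (f w)"
      by (rule mult_right_mono) simp
    also have "\<dots> \<le> 2 ^ ?n * (B 0 + B (2 * ?n))"
      unfolding mult.assoc using B[of w 0] B[of w "2 * ?n"]
      by (intro mult_left_mono) (auto simp: distrib_right)
    finally show ?thesis
      using decay_pos[of w] by (simp add: field_simps)
  qed
  then show thesis by (rule that)
qed

definition gaussian :: "real ^ 'n::finite \<Rightarrow> real"
  where "gaussian w = exp (- (norm w)\<^sup>2)"

lemma gaussian_measurable [measurable]: "gaussian \<in> borel_measurable borel"
  unfolding gaussian_def[abs_def] by measurable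

lemma exp_square_le_decay: "exp (- (norm w)\<^sup>2 / 2) \<le> 2 ^ CARD('n) * decay w" for w :: "real ^ 'n::finite"
proof -
  have n: "(norm w)\<^sup>2 = (\<Sum>i\<in>UNIV. (w $ i)\<^sup>2)"
    unfolding power2_norm_eq_inner inner_vec_def by (simp add: power2_eq_square)
  have "exp (- s\<^sup>2 / 2) \<le> 2 * (1 / (1 + s\<^sup>2))" for s :: real
  proof -
    have "(1 + s\<^sup>2) / 2 \<le> exp (s\<^sup>2 / 2)"
      using exp_ge_add_one_self[of "s\<^sup>2 / 2"] zero_le_power2[of s] by argo
    then show ?thesis
      by (simp add: exp_minus field_simps add_pos_nonneg)
  qed
  then have "(\<Prod>i\<in>UNIV. exp (- (w $ i)\<^sup>2 / 2)) \<le> (\<Prod>i\<in>UNIV. 2 * (1 / (1 + (w $ i)\<^sup>2)))"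
    by (intro prod_mono) auto
  also have "\<dots> = 2 ^ CARD('n) * decay w"
    by (simp only: prod.distrib decay_def prod_constant)
  also have "(\<Prod>i\<in>UNIV. exp (- (w $ i)\<^sup>2 / 2)) = exp (- (norm w)\<^sup>2 / 2)"
    by (simp add: n exp_sum[symmetric] sum_divide_distrib sum_negf)
  finally show ?thesis .
qed

lemma gaussian_le_decay: "gaussian w \<le> 2 ^ CARD('n) * decay w" for w :: "real ^ 'n::finite"
  using exp_square_le_decay[of w] by (rule order_trans[rotated]) (simp add: gaussian_def)

text \<open>The factor \<open>z\<close> in the derivative of \<open>exp(-z\<^sup>2)\<close> is absorbed by half of the exponent.\<close>

lemma exp_square_diff:
  fixes s t :: real
  assumes "0 \<le> s" "s \<le> t"
  shows "\<bar>exp (- s\<^sup>2) - exp (- t\<^sup>2)\<bar> \<le> 2 * exp (- s\<^sup>2 / 2) * (t - s)"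
proof (cases "s = t")
  case False
  then have "s < t" using assms by simp
  have "\<exists>z>s. z < t \<and> exp (- t\<^sup>2) - exp (- s\<^sup>2) = (t - s) * (- (2 * z * exp (- z\<^sup>2)))"
    using \<open>s < t\<close> by (intro MVT2) (auto intro!: derivative_eq_intros)
  then obtain z where z: "s < z" "z < t"
    "exp (- t\<^sup>2) - exp (- s\<^sup>2) = (t - s) * (- (2 * z * exp (- z\<^sup>2)))" by blast
  have "z * exp (- z\<^sup>2) \<le> exp (z\<^sup>2 / 2) * exp (- z\<^sup>2)"
  proof (rule mult_right_mono)
    have "2 * z \<le> 1 + z\<^sup>2"
      using zero_le_power2[of "z - 1"] by (simp add: power2_diff)
    then show "z \<le> exp (z\<^sup>2 / 2)"
      using exp_ge_add_one_self[of "z\<^sup>2 / 2"] by argo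
  qed simp
  also have "\<dots> = exp (- z\<^sup>2 / 2)"
    by (simp add: exp_add[symmetric])
  also have "\<dots> \<le> exp (- s\<^sup>2 / 2)"
    using z assms by simp
  finally have "2 * z * exp (- z\<^sup>2) \<le> 2 * exp (- s\<^sup>2 / 2)" by simp
  then have "(t - s) * (2 * z * exp (- z\<^sup>2)) \<le> (t - s) * (2 * exp (- s\<^sup>2 / 2))"
    using assms by (intro mult_left_mono) auto
  moreover have "0 \<le> (t - s) * (2 * z * exp (- z\<^sup>2))"
    using assms z by auto
  ultimately show ?thesis
    using z(3) by (simp add: mult_ac)
qed simp

lemma gaussian_diff_bound:
  fixes w w' :: "real ^ 'n::finite"
  shows "\<bar>gaussian w - gaussian w'\<bar> \<le>
    min 1 (norm (w - w')) * (2 ^ (CARD('n) + 1) * (decay w + decay w'))"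
proof -
  let ?h = "\<lambda>w :: real ^ 'n. exp (- (norm w)\<^sup>2 / 2)"
  have "\<bar>gaussian w - gaussian w'\<bar> \<le> min 1 (norm (w - w')) * (2 * (?h w + ?h w'))"
  proof -
    have "gaussian v \<le> ?h v" "0 \<le> gaussian v" for v :: "real ^ 'n"
      by (simp_all add: gaussian_def)
    then have 1: "\<bar>gaussian w - gaussian w'\<bar> \<le> 1 * (2 * (?h w + ?h w'))"
      by (smt (verit, best) exp_gt_zero)
    have "\<bar>gaussian w - gaussian w'\<bar> \<le> 2 * (?h w + ?h w') * \<bar>norm w - norm w'\<bar>"
    proof (cases "norm w \<le> norm w'")
      case True
      have "\<bar>gaussian w - gaussian w'\<bar> \<le> 2 * ?h w * (norm w' - norm w)"
        unfolding gaussian_def using True by (intro exp_square_diff) auto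
      also have "\<dots> \<le> 2 * (?h w + ?h w') * (norm w' - norm w)"
        using True by (intro mult_right_mono) auto
      finally show ?thesis using True by simp
    next
      case False
      have "\<bar>gaussian w' - gaussian w\<bar> \<le> 2 * ?h w' * (norm w - norm w')"
        unfolding gaussian_def using False by (intro exp_square_diff) auto
      also have "\<dots> \<le> 2 * (?h w + ?h w') * (norm w - norm w')"
        using False by (intro mult_right_mono) auto
      finally show ?thesis using False by (simp add: abs_minus_commute)
    qed
    also have "\<dots> \<le> 2 * (?h w + ?h w') * norm (w - w')"
      by (intro mult_left_mono norm_triangle_ineq3) (auto simp: add_nonneg_nonneg)
    finally show ?thesis
      using 1 by (simp add: min_def mult_ac)
  qed
  also have "\<dots> \<le> min 1 (norm (w - w')) * (2 ^ (CARD('n) + 1) * (decay w + decay w'))"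
    using exp_square_le_decay[of w] exp_square_le_decay[of w']
    by (intro mult_left_mono) (auto simp: algebra_simps)
  finally show ?thesis .
qed

lemma gaussian_diff_powr_bound:
  fixes p :: real
  assumes p: "1 \<le> p"
  obtains C where "0 \<le> C" "\<And>w w' :: real ^ 'n::finite.
    \<bar>gaussian w - gaussian w'\<bar> powr p \<le> C * min 1 (norm (w - w')) powr p * (decay w + decay w')"
proof
  let ?K = "2 ^ (CARD('n) + 1) :: real"
  define C where "C = ?K powr p * 2 powr (p - 1)"
  show "0 \<le> C"
    by (simp add: C_def)
  fix w w' :: "real ^ 'n"
  let ?d = "decay w + decay w'"
  have d: "0 < ?d" "?d \<le> 2"
    using decay_pos[of w] decay_pos[of w'] decay_le_1[of w] decay_le_1[of w'] by linarith+
  have "\<bar>gaussian w - gaussian w'\<bar> powr p \<le> (min 1 (norm (w - w')) * (?K * ?d)) powr p"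
    using gaussian_diff_bound[of w w'] p by (intro powr_mono2) auto
  also have "\<dots> = ?K powr p * min 1 (norm (w - w')) powr p * ?d powr p"
    using d by (simp add: powr_mult mult_ac)
  also have "?d powr p = ?d powr (p - 1) * ?d"
    using d by (simp add: powr_diff)
  also have "?K powr p * min 1 (norm (w - w')) powr p * (?d powr (p - 1) * ?d) \<le>
      ?K powr p * min 1 (norm (w - w')) powr p * (2 powr (p - 1) * ?d)"
    using d p by (intro mult_left_mono mult_right_mono powr_mono2) auto
  finally show "\<bar>gaussian w - gaussian w'\<bar> powr p \<le> C * min 1 (norm (w - w')) powr p * ?d"
    by (simp add: C_def mult_ac)
qed

text \<open>The weight sits at one of the two points only, and the kernel is integrated over the difference
  of the points last; the decay of the Gaussian then makes the weighted integral bounded uniformly in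
  that difference.\<close>

lemma weighted_gaussian_seminorm_finite:
  fixes p q c :: real
  assumes p: "1 \<le> p" and q: "0 < q" "q < p" and c: "-1 < c" "c \<le> 0"
  shows "(\<integral>\<^sup>+x\<in>half_space \<times> half_space. (case x of (w, w') \<Rightarrow>
      ennreal (last_coord w' powr c * \<bar>gaussian w - gaussian w'\<bar> powr p) *
      ennreal (norm (w - w') powr (- (real CARD('n::_) + q)))) \<partial>(lborel :: ((real ^ 'n::{finite,linorder}) \<times> (real ^ 'n::_)) measure)) < \<infinity>"
proof -
  let ?H = "half_space :: (real ^ 'n::_) set"
  let ?k = "\<lambda>v::real ^ 'n::_. norm v powr (- (real CARD('n::_) + q))"
  let ?y = "\<lambda>w::real ^ 'n::_. ennreal (last_coord w powr c) * indicator ?H w"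
  obtain C where C: "0 \<le> C" "\<And>w w' :: real ^ 'n::_.
      \<bar>gaussian w - gaussian w'\<bar> powr p \<le> C * min 1 (norm (w - w')) powr p * (decay w + decay w')"
    using gaussian_diff_powr_bound[OF p] by metis
  obtain M where M: "M < \<infinity>" "\<And>z :: real ^ 'n::_.
      (\<integral>\<^sup>+w\<in>half_space. ennreal (last_coord w powr c) * ennreal (decay (w + z)) \<partial>lborel) \<le> M"
    using uniform_decay_bound[OF c] by blast
  define k where "k = (\<lambda>v::real ^ 'n::_. ennreal (C * (min 1 (norm v) powr p * ?k v)))"
  have [measurable]: "k \<in> borel_measurable borel"
    unfolding k_def by measurable
  have kfin: "(\<integral>\<^sup>+v. k v \<partial>lborel) < \<infinity>"
    using truncated_kernel_finite[OF q, where 'n = 'n] C(1)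
    by (simp add: k_def ennreal_mult nn_integral_cmult ennreal_mult_less_top)
  have "(\<integral>\<^sup>+x\<in>?H \<times> ?H. (case x of (w, w') \<Rightarrow>
      ennreal (last_coord w' powr c * \<bar>gaussian w - gaussian w'\<bar> powr p) * ennreal (?k (w - w'))) \<partial>lborel) \<le>
      (\<integral>\<^sup>+x. (case x of (w, w') \<Rightarrow> ?y w' * k (w - w') * ennreal (decay w + decay w')) \<partial>(lborel \<Otimes>\<^sub>M lborel))"
    unfolding lborel_prod
  proof (rule nn_integral_mono, clarify)
    fix w w' :: "real ^ 'n::_"
    have "\<bar>gaussian w - gaussian w'\<bar> powr p * ?k (w - w') \<le>
        C * min 1 (norm (w - w')) powr p * (decay w + decay w') * ?k (w - w')"
      using C(2) by (rule mult_right_mono) simp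
    then have "ennreal (\<bar>gaussian w - gaussian w'\<bar> powr p * ?k (w - w')) \<le>
        k (w - w') * ennreal (decay w + decay w')"
      using decay_pos[of w] decay_pos[of w'] C(1)
      by (simp add: k_def ennreal_mult[symmetric] mult_ac ennreal_leI del: ennreal_plus)
    from mult_left_mono[OF this, of "?y w'"]
    show "ennreal (last_coord w' powr c * \<bar>gaussian w - gaussian w'\<bar> powr p) * ennreal (?k (w - w')) *
        indicator (?H \<times> ?H) (w, w') \<le> ?y w' * k (w - w') * ennreal (decay w + decay w')"
      by (cases "w \<in> ?H"; cases "w' \<in> ?H") (simp_all add: ennreal_mult mult_ac)
  qed
  also have "\<dots> = (\<integral>\<^sup>+w'. (\<integral>\<^sup>+w. ?y w' * k (w - w') * ennreal (decay w + decay w') \<partial>lborel) \<partial>lborel)"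
    by (subst lborel_pair.nn_integral_snd[symmetric]) simp_all
  also have "\<dots> = (\<integral>\<^sup>+w'. (\<integral>\<^sup>+z. ?y w' * k z * ennreal (decay (w' + z) + decay (w' + 0)) \<partial>lborel) \<partial>lborel)"
  proof (rule nn_integral_cong)
    fix w' :: "real ^ 'n::_"
    show "(\<integral>\<^sup>+w. ?y w' * k (w - w') * ennreal (decay w + decay w') \<partial>lborel) =
        (\<integral>\<^sup>+z. ?y w' * k z * ennreal (decay (w' + z) + decay (w' + 0)) \<partial>lborel)"
      by (subst nn_integral_lborel_affine[of 1 _ w']) simp_all
  qed
  also have "\<dots> = (\<integral>\<^sup>+z. (\<integral>\<^sup>+w'. ?y w' * k z * ennreal (decay (w' + z) + decay (w' + 0)) \<partial>lborel) \<partial>lborel)"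
    by (rule lborel_pair.Fubini') measurable
  also have "\<dots> \<le> (\<integral>\<^sup>+z. k z * (2 * M) \<partial>lborel)"
  proof (rule nn_integral_mono)
    fix z :: "real ^ 'n::_"
    let ?I = "\<lambda>z. \<integral>\<^sup>+w\<in>?H. ennreal (last_coord w powr c) * ennreal (decay (w + z)) \<partial>lborel"
    have "(\<integral>\<^sup>+w'. ?y w' * k z * ennreal (decay (w' + z) + decay (w' + 0)) \<partial>lborel) =
        (\<integral>\<^sup>+w'. k z * (ennreal (last_coord w' powr c) * ennreal (decay (w' + z)) * indicator ?H w' +
          ennreal (last_coord w' powr c) * ennreal (decay (w' + 0)) * indicator ?H w') \<partial>lborel)"
      by (intro nn_integral_cong)
        (simp only: ennreal_plus less_imp_le[OF decay_pos] distrib_left distrib_right mult_ac)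
    also have "\<dots> = k z * (?I z + ?I 0)"
      by (simp add: nn_integral_cmult nn_integral_add)
    also have "\<dots> \<le> k z * (2 * M)"
      unfolding mult_2 by (intro mult_left_mono add_mono M(2)) simp
    finally show "(\<integral>\<^sup>+w'. ?y w' * k z * ennreal (decay (w' + z) + decay (w' + 0)) \<partial>lborel) \<le> k z * (2 * M)" .
  qed
  also have "\<dots> = (\<integral>\<^sup>+z. k z \<partial>lborel) * (2 * M)"
    by (intro nn_integral_multc) measurable
  also have "\<dots> < \<infinity>"
    using kfin M(1) by (simp add: ennreal_mult_less_top)
  finally show ?thesis .
qed


section \<open>Schwartz functions approximating the ground state\<close>

definition regularised_ground_state :: "real \<Rightarrow> real \<Rightarrow> real ^ 'n::{finite,linorder} \<Rightarrow> real"
  where "regularised_ground_state d b w = (d\<^sup>2 + (last_coord w)\<^sup>2) powr b * gaussian w"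

text \<open>The functions obtained from the regularised ground states of all exponents by linear combinations and
  multiplication by coordinates. A derivative of a regularised ground state only
  shifts the exponent and produces coordinate factors, so this set is closed under partial
  derivatives, and all its elements decay rapidly.\<close>

inductive_set coordinate_module :: "real \<Rightarrow> (real ^ 'n::{finite,linorder} \<Rightarrow> real) set"
  for d :: real where
  base: "regularised_ground_state d b \<in> coordinate_module d"
| coordinate: "f \<in> coordinate_module d \<Longrightarrow> (\<lambda>w. w $ i * f w) \<in> coordinate_module d"
| add: "f \<in> coordinate_module d \<Longrightarrow> g \<in> coordinate_module d \<Longrightarrow> (\<lambda>w. f w + g w) \<in> coordinate_module d"
| scale: "f \<in> coordinate_module d \<Longrightarrow> (\<lambda>w. r * f w) \<in> coordinate_module d"

lemma regularised_ground_state_has_derivative: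
  fixes w :: "real ^ 'n::{finite,linorder}"
  assumes d: "0 < d"
  shows "(regularised_ground_state d b has_derivative (\<lambda>h.
    2 * b * (last_coord w * regularised_ground_state d (b - 1) w) * last_coord h
      - 2 * (w \<bullet> h) * regularised_ground_state d b w)) (at w)"
proof -
  let ?X = "\<lambda>w::real ^ 'n::_. d\<^sup>2 + (last_coord w)\<^sup>2"
  have X: "0 < ?X w"
    using d by (simp add: add_pos_nonneg)
  have dX: "(?X has_derivative (\<lambda>h. 2 * last_coord w * last_coord h)) (at w)"
    unfolding last_coord_inner by (auto intro!: derivative_eq_intros)
  have "((\<lambda>w. ?X w powr b) has_derivative
      (\<lambda>h. ?X w powr b * (0 * ln (?X w) + 2 * last_coord w * last_coord h * b / ?X w))) (at w)"
    using X by (intro has_derivative_powr[OF dX has_derivative_const]) auto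
  moreover have "(gaussian has_derivative (\<lambda>h. gaussian w * (- 2 * (w \<bullet> h)))) (at w)"
    unfolding gaussian_def[abs_def] power2_norm_eq_inner
    by (auto intro!: derivative_eq_intros simp: inner_commute)
  ultimately have "((\<lambda>w. ?X w powr b * gaussian w) has_derivative
      (\<lambda>h. ?X w powr b * (gaussian w * (- 2 * (w \<bullet> h))) +
        ?X w powr b * (0 * ln (?X w) + 2 * last_coord w * last_coord h * b / ?X w) * gaussian w)) (at w)"
    by (rule has_derivative_mult)
  moreover have "?X w powr (b - 1) = ?X w powr b / ?X w"
    using X by (simp add: powr_diff)
  ultimately show ?thesis
    unfolding regularised_ground_state_def[abs_def]
    by (auto elim!: has_derivative_eq_rhs simp: fun_eq_iff algebra_simps)
qed

lemma coordinate_module_derivative: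
  fixes f :: "real ^ 'n::{finite,linorder} \<Rightarrow> real"
  assumes d: "0 < d" and f: "f \<in> coordinate_module d"
  shows "\<exists>f'. (\<forall>x. (f has_derivative f' x) (at x)) \<and> (\<forall>j. (\<lambda>x. f' x (axis j 1)) \<in> coordinate_module d)"
  using f
proof induction
  case (base b)
  let ?f' = "\<lambda>w h. 2 * b * (last_coord w * regularised_ground_state d (b - 1) w) * last_coord h
      - 2 * (w \<bullet> h) * regularised_ground_state d b w"
  have "(\<lambda>x. ?f' x (axis j 1)) \<in> coordinate_module d" for j :: 'n
  proof -
    have "(\<lambda>x. ?f' x (axis j 1)) = (\<lambda>x. (2 * b * last_coord (axis j 1 :: real ^ 'n::_)) *
        (x $ Max UNIV * regularised_ground_state d (b - 1) x) + (- 2) * (x $ j * regularised_ground_state d b x))"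
      by (simp add: fun_eq_iff last_coord_def inner_axis)
    then show ?thesis
      by (simp only:) (intro coordinate_module.intros)
  qed
  then show ?case
    using regularised_ground_state_has_derivative[OF d] by (intro exI[of _ ?f']) blast
next
  case (coordinate f i)
  then obtain f' where f': "\<And>x. (f has_derivative f' x) (at x)"
    "\<And>j. (\<lambda>x. f' x (axis j 1)) \<in> coordinate_module d" by blast
  show ?case
  proof (intro exI conjI allI)
    show "((\<lambda>w. w $ i * f w) has_derivative (\<lambda>h. x $ i * f' x h + h $ i * f x)) (at x)" for x
      by (intro has_derivative_mult f'(1) bounded_linear.has_derivative[OF bounded_linear_vec_nth] has_derivative_ident)
    fix j :: 'n
    show "(\<lambda>x. x $ i * f' x (axis j 1) + axis j 1 $ i * f x) \<in> coordinate_module d"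
      by (intro coordinate_module.intros f'(2) coordinate)
  qed
next
  case (add f g)
  then obtain f' g' where f': "\<And>x. (f has_derivative f' x) (at x)"
    "\<And>j. (\<lambda>x. f' x (axis j 1)) \<in> coordinate_module d"
    and g': "\<And>x. (g has_derivative g' x) (at x)"
    "\<And>j. (\<lambda>x. g' x (axis j 1)) \<in> coordinate_module d" by blast
  show ?case
  proof (intro exI conjI allI)
    show "((\<lambda>w. f w + g w) has_derivative (\<lambda>h. f' x h + g' x h)) (at x)" for x
      by (intro has_derivative_add f'(1) g'(1))
    show "(\<lambda>x. f' x (axis j 1) + g' x (axis j 1)) \<in> coordinate_module d" for j
      by (intro coordinate_module.intros f'(2) g'(2))
  qed
next
  case (scale f r)
  then obtain f' where f': "\<And>x. (f has_derivative f' x) (at x)"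
    "\<And>j. (\<lambda>x. f' x (axis j 1)) \<in> coordinate_module d" by blast
  show ?case
  proof (intro exI conjI allI)
    show "((\<lambda>w. r * f w) has_derivative (\<lambda>h. r * f' x h)) (at x)" for x
      by (intro has_derivative_mult_right f'(1))
    show "(\<lambda>x. r * f' x (axis j 1)) \<in> coordinate_module d" for j
      by (intro coordinate_module.intros f'(2))
  qed
qed

lemma powr_le_exp_quarter:
  assumes b: "0 < (b::real)"
  obtains C where "0 \<le> C" "\<And>X. 0 < X \<Longrightarrow> X powr b \<le> C * exp (X / 4)"
proof
  show "0 \<le> exp (b * ln (4 * b) - b)" by simp
  fix X :: real
  assume X: "0 < X"
  have "ln (X / (4 * b)) \<le> X / (4 * b) - 1"
    using X b by (intro ln_le_minus_one) simp
  then have "b * ln X \<le> b * (X / (4 * b) - 1 + ln (4 * b))"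
    using X b by (intro mult_left_mono) (auto simp: ln_div)
  also have "\<dots> = (b * ln (4 * b) - b) + X / 4"
    using b by (simp add: field_simps)
  finally show "X powr b \<le> exp (b * ln (4 * b) - b) * exp (X / 4)"
    using X by (simp add: powr_def exp_add[symmetric])
qed

text \<open>Both the power of \<open>|x|\<close> and the power of \<open>d\<^sup>2 + y\<^sup>2\<close> are at most of the order of
  \<open>exp(|x|\<^sup>2 / 4)\<close>, which leaves half of the Gaussian exponent unused. The lower bound \<open>d\<^sup>2\<close> takes care of
  negative exponents.\<close>

lemma coordinate_module_bounded:
  fixes f :: "real ^ 'n::{finite,linorder} \<Rightarrow> real"
  assumes d: "0 < d" and f: "f \<in> coordinate_module d"
  shows "\<exists>B. \<forall>x. norm x ^ k * \<bar>f x\<bar> \<le> B"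
  using f
proof (induction arbitrary: k)
  case (base b)
  obtain C where C: "0 \<le> C" "\<And>X. 0 < X \<Longrightarrow> X powr (real k + 1) \<le> C * exp (X / 4)"
    using powr_le_exp_quarter[of "real k + 1"] by (metis add_nonneg_pos of_nat_0_le_iff zero_less_one)
  obtain D where D: "0 \<le> D" "\<And>X. 0 < X \<Longrightarrow> X powr (\<bar>b\<bar> + 1) \<le> D * exp (X / 4)"
    using powr_le_exp_quarter[of "\<bar>b\<bar> + 1"] by (metis abs_ge_zero add_nonneg_pos zero_less_one)
  let ?m = "(d\<^sup>2) powr (b - (\<bar>b\<bar> + 1))"
  have "norm x ^ k * \<bar>regularised_ground_state d b x\<bar> \<le> C * exp (1 / 4) * (?m * D * exp (d\<^sup>2 / 4))"
    for x :: "real ^ 'n::_"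
  proof -
    let ?X = "d\<^sup>2 + (last_coord x)\<^sup>2" and ?r = "(norm x)\<^sup>2"
    have d2: "0 < d\<^sup>2" using d by simp
    have y: "(last_coord x)\<^sup>2 \<le> ?r"
      using component_le_norm_cart[of x "Max UNIV"] by (simp add: last_coord_def abs_le_square_iff[symmetric])
    have "norm x ^ k \<le> (1 + ?r) ^ k"
    proof (rule power_mono)
      have "0 \<le> (norm x - 1)\<^sup>2 + ?r + 1" by simp
      then show "norm x \<le> 1 + ?r" by (simp add: power2_diff)
    qed simp
    also have "\<dots> \<le> (1 + ?r) powr (real k + 1)"
      using powr_mono[of "real k" "real k + 1" "1 + ?r"] by (simp add: powr_realpow add_pos_nonneg)
    also have "\<dots> \<le> C * exp ((1 + ?r) / 4)"
      by (intro C(2) add_pos_nonneg) auto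
    finally have 1: "norm x ^ k \<le> C * exp ((1 + ?r) / 4)" .
    have "?X powr b = ?X powr (b - (\<bar>b\<bar> + 1)) * ?X powr (\<bar>b\<bar> + 1)"
      by (simp add: powr_add[symmetric])
    also have "\<dots> \<le> ?m * (D * exp (?X / 4))"
      using d2 by (intro mult_mono D(2) powr_mono2') (auto simp: add_pos_nonneg)
    also have "\<dots> \<le> ?m * (D * exp ((d\<^sup>2 + ?r) / 4))"
      using y D(1) by (intro mult_left_mono) auto
    finally have 2: "?X powr b \<le> ?m * (D * exp ((d\<^sup>2 + ?r) / 4))" .
    have "norm x ^ k * \<bar>regularised_ground_state d b x\<bar> = norm x ^ k * ?X powr b * exp (- ?r)"
      by (simp add: regularised_ground_state_def gaussian_def)
    also have "\<dots> \<le> C * exp ((1 + ?r) / 4) * (?m * (D * exp ((d\<^sup>2 + ?r) / 4))) * exp (- ?r / 2)"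
      using C(1) D(1) by (intro mult_mono 1 2) auto
    also have "\<dots> = C * exp (1 / 4) * (?m * D * exp (d\<^sup>2 / 4)) * (exp (?r / 4) * exp (?r / 4) * exp (- ?r / 2))"
      by (simp add: add_divide_distrib exp_add mult_ac)
    also have "exp (?r / 4) * exp (?r / 4) * exp (- ?r / 2) = 1"
      by (simp add: exp_add[symmetric])
    finally show ?thesis by simp
  qed
  then show ?case by blast
next
  case (coordinate f i)
  then obtain B where B: "\<And>x. norm x ^ Suc k * \<bar>f x\<bar> \<le> B" by blast
  have "norm x ^ k * \<bar>x $ i * f x\<bar> \<le> B" for x
  proof -
    have "norm x ^ k * (\<bar>x $ i\<bar> * \<bar>f x\<bar>) \<le> norm x ^ k * (norm x * \<bar>f x\<bar>)"
      by (intro mult_left_mono mult_right_mono component_le_norm_cart) auto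
    then show ?thesis
      using B[of x] by (simp add: abs_mult mult_ac)
  qed
  then show ?case by blast
next
  case (add f g)
  then obtain B B' where B: "\<And>x. norm x ^ k * \<bar>f x\<bar> \<le> B" "\<And>x. norm x ^ k * \<bar>g x\<bar> \<le> B'" by metis
  have "norm x ^ k * \<bar>f x + g x\<bar> \<le> B + B'" for x
  proof -
    have "norm x ^ k * \<bar>f x + g x\<bar> \<le> norm x ^ k * (\<bar>f x\<bar> + \<bar>g x\<bar>)"
      by (intro mult_left_mono) auto
    then show ?thesis
      using B[of x] by (simp add: distrib_left)
  qed
  then show ?case by blast
next
  case (scale f r)
  then obtain B where B: "\<And>x. norm x ^ k * \<bar>f x\<bar> \<le> B" by blast
  have "norm x ^ k * \<bar>r * f x\<bar> \<le> \<bar>r\<bar> * B" for x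
    using mult_left_mono[OF B[of x], of "\<bar>r\<bar>"] by (simp add: abs_mult mult_ac)
  then show ?case by blast
qed

lemma iter_partial_coordinate_module:
  fixes f :: "real ^ 'n::{finite,linorder} \<Rightarrow> real"
  assumes d: "0 < d" and f: "f \<in> coordinate_module d"
  shows "\<exists>g\<in>coordinate_module d. iter_partial is (\<lambda>w. complex_of_real (f w)) = (\<lambda>w. complex_of_real (g w))"
proof (induction "is")
  case Nil
  then show ?case
    using f by (auto simp: iter_partial_def)
next
  case (Cons i "is")
  then obtain g where g: "g \<in> coordinate_module d"
    "iter_partial is (\<lambda>w. complex_of_real (f w)) = (\<lambda>w. complex_of_real (g w))" by blast
  obtain g' where g': "\<And>x. (g has_derivative g' x) (at x)"
    "\<And>j. (\<lambda>x. g' x (axis j 1)) \<in> coordinate_module d"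
    using coordinate_module_derivative[OF d g(1)] by blast
  have "frechet_derivative (\<lambda>w. complex_of_real (g w)) (at x) = (\<lambda>h. complex_of_real (g' x h))" for x
    using g'(1) by (intro frechet_derivative_at[symmetric] has_derivative_of_real)
  then have "iter_partial (i # is) (\<lambda>w. complex_of_real (f w)) = (\<lambda>x. complex_of_real (g' x (axis i 1)))"
    using g(2) by (simp add: iter_partial_def partial_def[abs_def])
  then show ?case
    using g'(2)[of i] by (intro bexI[of _ "\<lambda>x. g' x (axis i 1)"])
qed

lemma schwartz_coordinate_module:
  fixes f :: "real ^ 'n::{finite,linorder} \<Rightarrow> real"
  assumes d: "0 < d" and f: "f \<in> coordinate_module d"
  shows "schwartz (\<lambda>w. complex_of_real (f w))"
  unfolding schwartz_def
proof (intro conjI allI)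
  fix "is" :: "'n list" and x :: "real ^ 'n::_" and k :: nat
  obtain g where g: "g \<in> coordinate_module d"
    "iter_partial is (\<lambda>w. complex_of_real (f w)) = (\<lambda>w. complex_of_real (g w))"
    using iter_partial_coordinate_module[OF assms] by blast
  show "iter_partial is (\<lambda>w. complex_of_real (f w)) differentiable (at x)"
    unfolding g(2) differentiable_def
    using coordinate_module_derivative[OF d g(1)] has_derivative_of_real by blast
  obtain B where "\<And>x. norm x ^ k * \<bar>g x\<bar> \<le> B"
    using coordinate_module_bounded[OF d g(1)] by blast
  then show "bounded (range (\<lambda>x. norm x ^ k *\<^sub>R iter_partial is (\<lambda>w. complex_of_real (f w)) x))"
    unfolding g(2) bounded_iff by auto
qed


section \<open>Optimality of the constant\<close>

abbreviation trial :: "real \<Rightarrow> real \<Rightarrow> real ^ 'n::{finite,linorder} \<Rightarrow> complex"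
  where "trial d a w \<equiv> complex_of_real (regularised_ground_state d (a / 2) w)"

lemma schwartz_trial: "0 < d \<Longrightarrow> schwartz (trial d a)"
  by (rule schwartz_coordinate_module[OF _ coordinate_module.base])

lemma regularised_ground_state_measurable [measurable]: "regularised_ground_state d b \<in> borel_measurable borel"
  unfolding regularised_ground_state_def[abs_def] by measurable

lemma regularised_power_le:
  fixes a d y :: real
  assumes "a \<le> 0" "0 < y"
  shows "(d\<^sup>2 + y\<^sup>2) powr (a / 2) \<le> y powr a"
proof -
  have "(d\<^sup>2 + y\<^sup>2) powr (a / 2) \<le> (y\<^sup>2) powr (a / 2)"
    using assms by (intro powr_mono2') auto
  also have "\<dots> = y powr a"
    using assms powr_powr[of y 2 "a / 2"] by simp
  finally show ?thesis .
qed

text \<open>The quotient \<open>\<rho>\<close> of the two bases lies between 1 and \<open>r\<^sup>2\<close>. Hence the regularised power varies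
  under dilation relatively less than \<open>y\<^sup>a\<close> itself, so that the regularisation costs nothing in
  the constant.\<close>

lemma regularised_power_dilation:
  fixes a d y r :: real
  assumes a: "a \<le> 0" and y: "0 < y" and r: "0 < r"
  shows "\<bar>(d\<^sup>2 + y\<^sup>2) powr (a / 2) - (d\<^sup>2 + (r * y)\<^sup>2) powr (a / 2)\<bar> \<le>
    \<bar>1 - r powr a\<bar> * (d\<^sup>2 + y\<^sup>2) powr (a / 2)"
proof -
  define \<rho> where "\<rho> = (d\<^sup>2 + (r * y)\<^sup>2) / (d\<^sup>2 + y\<^sup>2)"
  have X: "0 < d\<^sup>2 + y\<^sup>2" "0 < d\<^sup>2 + (r * y)\<^sup>2"
    using y r by (auto intro!: add_nonneg_pos)
  then have \<rho>: "0 < \<rho>" "d\<^sup>2 + (r * y)\<^sup>2 = \<rho> * (d\<^sup>2 + y\<^sup>2)"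
    by (auto simp: \<rho>_def)
  have r2: "(r\<^sup>2) powr (a / 2) = r powr a"
    using r powr_powr[of r 2 "a / 2"] by simp
  have "\<bar>1 - \<rho> powr (a / 2)\<bar> \<le> \<bar>1 - r powr a\<bar>"
  proof (cases "1 \<le> r")
    case True
    then have "1 \<le> r\<^sup>2" by simp
    then have "1 * y\<^sup>2 \<le> r\<^sup>2 * y\<^sup>2" "1 * d\<^sup>2 \<le> r\<^sup>2 * d\<^sup>2"
      by (intro mult_right_mono; simp)+
    then have "1 \<le> \<rho>" "\<rho> \<le> r\<^sup>2"
      using X by (auto simp: \<rho>_def divide_le_eq power_mult_distrib algebra_simps)
    then have "\<rho> powr (a / 2) \<le> 1 powr (a / 2)" "(r\<^sup>2) powr (a / 2) \<le> \<rho> powr (a / 2)"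
      using a powr_mono2'[of "a / 2" 1 \<rho>] powr_mono2'[of "a / 2" \<rho> "r\<^sup>2"] by auto
    then show ?thesis using r2 by simp
  next
    case False
    then have "r\<^sup>2 \<le> 1"
      using r by (simp add: power_le_one)
    then have "r\<^sup>2 * y\<^sup>2 \<le> 1 * y\<^sup>2" "r\<^sup>2 * d\<^sup>2 \<le> 1 * d\<^sup>2"
      by (intro mult_right_mono; simp)+
    then have "\<rho> \<le> 1" "r\<^sup>2 \<le> \<rho>"
      using X by (auto simp: \<rho>_def le_divide_eq power_mult_distrib algebra_simps)
    then have "1 powr (a / 2) \<le> \<rho> powr (a / 2)" "\<rho> powr (a / 2) \<le> (r\<^sup>2) powr (a / 2)"
      using a r \<rho>(1) powr_mono2'[of "a / 2" \<rho> 1] powr_mono2'[of "a / 2" "r\<^sup>2" \<rho>] by auto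
    then show ?thesis using r2 by simp
  qed
  then have "\<bar>1 - \<rho> powr (a / 2)\<bar> * (d\<^sup>2 + y\<^sup>2) powr (a / 2) \<le> \<bar>1 - r powr a\<bar> * (d\<^sup>2 + y\<^sup>2) powr (a / 2)"
    by (rule mult_right_mono) simp
  moreover have "(d\<^sup>2 + y\<^sup>2) powr (a / 2) - (d\<^sup>2 + (r * y)\<^sup>2) powr (a / 2) =
      (1 - \<rho> powr (a / 2)) * (d\<^sup>2 + y\<^sup>2) powr (a / 2)"
    unfolding \<rho>(2) powr_mult by (simp add: left_diff_distrib)
  ultimately show ?thesis
    by (simp add: abs_mult)
qed

text \<open>The part of the seminorm of a trial function in which the Gaussian factor varies; the weight at
  \<open>w'\<close> majorises the other factor.\<close>

definition gaussian_remainder :: "'n::{finite,linorder} itself \<Rightarrow> real \<Rightarrow> real \<Rightarrow> real \<Rightarrow> ennreal"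
  where "gaussian_remainder _ p q c = (\<integral>\<^sup>+x\<in>half_space \<times> half_space. (case x of (w, w') \<Rightarrow>
      ennreal (last_coord w' powr c * \<bar>gaussian w - gaussian w'\<bar> powr p) *
      ennreal (norm (w - w') powr (- (real CARD('n::_) + q)))) \<partial>(lborel :: ((real ^ 'n::_) \<times> (real ^ 'n::_)) measure))"

text \<open>The difference is split as
  \<open>(g(y) - g(y')) G(w) + g(y') (G(w) - G(w'))\<close> with \<open>g(y) = (d\<^sup>2 + y\<^sup>2)\<^sup>a\<^sup>/\<^sup>2\<close>. In the first summand the Gaussian is taken
  at \<open>w\<close>, so after the substitution it is not affected by \<open>u\<close>. The second summand no longer depends on
  \<open>d\<close> after the bound \<open>g(y') \<le> y'\<^sup>a\<close>.\<close>

lemma gagliardo_trial_le: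
  fixes p \<beta> d l :: real
  assumes p: "1 \<le> p" "p * \<beta> < 1" and l: "0 < l" "l < 1"
  defines "a \<equiv> \<beta> - 1 / p"
  shows "gagliardo_integral p \<beta> (trial d a :: real ^ 'n::{finite,linorder} \<Rightarrow> complex) \<le>
    ennreal ((1 - l) powr (1 - p)) * (ground_state_integral TYPE('n::_) p \<beta> *
      hardy_integral p \<beta> (trial d a :: real ^ 'n::_ \<Rightarrow> complex)) +
    ennreal (l powr (1 - p)) * gaussian_remainder TYPE('n::_) p (p * \<beta>) (p * \<beta> - 1)"
proof -
  let ?H = "half_space :: (real ^ 'n::_) set"
  define q where "q = p * \<beta>"
  have qa: "q - 1 = a * p"
    using p by (simp add: q_def a_def field_simps)
  have a: "a \<le> 0"
    using p by (simp add: a_def field_simps)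
  define g where "g = (\<lambda>y. (d\<^sup>2 + y\<^sup>2) powr (a / 2))"
  have [measurable]: "g \<in> borel_measurable borel"
    unfolding g_def by measurable
  let ?y = "last_coord :: real ^ 'n::_ \<Rightarrow> real"
  let ?k = "\<lambda>v::real ^ 'n::_. ennreal (norm v powr (- (real CARD('n::_) + q)))"
  let ?\<Phi>1 = "\<lambda>w w'. ennreal (\<bar>g (?y w) - g (?y w')\<bar> powr p * gaussian w powr p)"
  let ?\<Phi>2 = "\<lambda>w w'. ennreal (?y w' powr (q - 1) * \<bar>gaussian w - gaussian w'\<bar> powr p)"
  have trial: "trial d a w = complex_of_real (g (?y w) * gaussian w)" for w
    by (simp add: regularised_ground_state_def g_def)
  have [measurable]: "case_prod ?\<Phi>1 \<in> borel_measurable (borel \<Otimes>\<^sub>M borel)"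
    "case_prod ?\<Phi>2 \<in> borel_measurable (borel \<Otimes>\<^sub>M borel)"
    by measurable
  have meas1: "case_prod ?\<Phi>1 \<in> borel_measurable borel"
    unfolding borel_prod[symmetric] by measurable
  have pointwise: "norm (trial d a w - trial d a w') powr p \<le>
      (1 - l) powr (1 - p) * (\<bar>g (?y w) - g (?y w')\<bar> powr p * gaussian w powr p) +
      l powr (1 - p) * (?y w' powr (q - 1) * \<bar>gaussian w - gaussian w'\<bar> powr p)"
    if w: "w' \<in> ?H" for w w'
  proof -
    have y: "0 < ?y w'"
      using w by (simp add: half_space_def)
    have G: "0 \<le> gaussian w" for w :: "real ^ 'n::_"
      by (simp add: gaussian_def)
    have "norm (trial d a w - trial d a w') = \<bar>(g (?y w) - g (?y w')) * gaussian w + g (?y w') * (gaussian w - gaussian w')\<bar>"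
      unfolding trial of_real_diff[symmetric] norm_of_real by (simp add: algebra_simps)
    also have "\<dots> \<le> \<bar>g (?y w) - g (?y w')\<bar> * gaussian w + ?y w' powr a * \<bar>gaussian w - gaussian w'\<bar>"
    proof -
      have "\<bar>g (?y w')\<bar> \<le> ?y w' powr a"
        using regularised_power_le[OF a y, of d] by (simp add: g_def)
      then have "\<bar>g (?y w') * (gaussian w - gaussian w')\<bar> \<le> ?y w' powr a * \<bar>gaussian w - gaussian w'\<bar>"
        unfolding abs_mult by (rule mult_right_mono) simp
      then show ?thesis
        using abs_triangle_ineq[of "(g (?y w) - g (?y w')) * gaussian w" "g (?y w') * (gaussian w - gaussian w')"] G[of w]
        by (simp add: abs_mult)
    qed
    finally have "norm (trial d a w - trial d a w') powr p \<le>
        (\<bar>g (?y w) - g (?y w')\<bar> * gaussian w + ?y w' powr a * \<bar>gaussian w - gaussian w'\<bar>) powr p"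
      using p by (intro powr_mono2) auto
    also have "\<dots> \<le> (1 - l) powr (1 - p) * (\<bar>g (?y w) - g (?y w')\<bar> * gaussian w) powr p +
        l powr (1 - p) * (?y w' powr a * \<bar>gaussian w - gaussian w'\<bar>) powr p"
      using powr_add_le_weighted[of "\<bar>g (?y w) - g (?y w')\<bar> * gaussian w" "?y w' powr a * \<bar>gaussian w - gaussian w'\<bar>" "1 - l" p]
        l p G[of w] by simp
    finally show ?thesis
      using G[of w] by (simp add: powr_mult powr_powr qa)
  qed
  have "gagliardo_integral p \<beta> (trial d a :: real ^ 'n::_ \<Rightarrow> complex) \<le>
      (\<integral>\<^sup>+x. ennreal ((1 - l) powr (1 - p)) * ((case x of (w, w') \<Rightarrow> ?\<Phi>1 w w' * ?k (w - w')) * indicator (?H \<times> ?H) x) +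
        ennreal (l powr (1 - p)) * ((case x of (w, w') \<Rightarrow> ?\<Phi>2 w w' * ?k (w - w')) * indicator (?H \<times> ?H) x)
        \<partial>(lborel \<Otimes>\<^sub>M lborel))"
    unfolding gagliardo_integral_def lborel_prod
  proof (rule nn_integral_mono, clarify)
    fix w w' :: "real ^ 'n::_"
    show "ennreal (norm (trial d a w - trial d a w') powr p / norm (w - w') powr (real CARD('n::_) + p * \<beta>)) *
        indicator (?H \<times> ?H) (w, w') \<le>
        ennreal ((1 - l) powr (1 - p)) * (?\<Phi>1 w w' * ?k (w - w') * indicator (?H \<times> ?H) (w, w')) +
        ennreal (l powr (1 - p)) * (?\<Phi>2 w w' * ?k (w - w') * indicator (?H \<times> ?H) (w, w'))"
    proof (cases "(w, w') \<in> ?H \<times> ?H")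
      case True
      then have "w' \<in> ?H" by simp
      from mult_right_mono[OF pointwise[OF this, of w], of "norm (w - w') powr (- (real CARD('n::_) + q))"]
      have "norm (trial d a w - trial d a w') powr p / norm (w - w') powr (real CARD('n::_) + p * \<beta>) \<le>
          (1 - l) powr (1 - p) * (\<bar>g (?y w) - g (?y w')\<bar> powr p * gaussian w powr p * norm (w - w') powr (- (real CARD('n::_) + q))) +
          l powr (1 - p) * (?y w' powr (q - 1) * \<bar>gaussian w - gaussian w'\<bar> powr p * norm (w - w') powr (- (real CARD('n::_) + q)))"
        unfolding q_def[symmetric] powr_minus_divide by (simp add: distrib_right add_divide_distrib mult.assoc)
      then show ?thesis
        using True by (simp add: ennreal_mult[symmetric] ennreal_plus[symmetric] ennreal_leI del: ennreal_plus)
    qed simp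
  qed
  also have "\<dots> = ennreal ((1 - l) powr (1 - p)) *
      (\<integral>\<^sup>+x\<in>?H \<times> ?H. (case x of (w, w') \<Rightarrow> ?\<Phi>1 w w' * ?k (w - w')) \<partial>(lborel \<Otimes>\<^sub>M lborel)) +
      ennreal (l powr (1 - p)) *
      (\<integral>\<^sup>+x\<in>?H \<times> ?H. (case x of (w, w') \<Rightarrow> ?\<Phi>2 w w' * ?k (w - w')) \<partial>(lborel \<Otimes>\<^sub>M lborel))"
    by (simp add: nn_integral_add nn_integral_cmult)
  also have "(\<integral>\<^sup>+x\<in>?H \<times> ?H. (case x of (w, w') \<Rightarrow> ?\<Phi>2 w w' * ?k (w - w')) \<partial>(lborel \<Otimes>\<^sub>M lborel)) =
      gaussian_remainder TYPE('n::_) p (p * \<beta>) (p * \<beta> - 1)"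
    unfolding gaussian_remainder_def q_def lborel_prod ..
  also have "(\<integral>\<^sup>+x\<in>?H \<times> ?H. (case x of (w, w') \<Rightarrow> ?\<Phi>1 w w' * ?k (w - w')) \<partial>(lborel \<Otimes>\<^sub>M lborel)) =
      (\<integral>\<^sup>+u\<in>?H. ?k (u - last_axis) *
      (\<integral>\<^sup>+w\<in>?H. ?\<Phi>1 w (half_map u w) * ennreal (?y w powr (- q)) \<partial>lborel) \<partial>lborel)"
    unfolding lborel_prod by (rule half_space_pairs_substitution[OF meas1])
  also have "\<dots> \<le> (\<integral>\<^sup>+u. (?k (u - last_axis) * ennreal (\<bar>1 - ?y u powr a\<bar> powr p) * indicator ?H u) *
      hardy_integral p \<beta> (trial d a :: real ^ 'n::_ \<Rightarrow> complex) \<partial>lborel)"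
  proof (rule nn_integral_mono)
    fix u :: "real ^ 'n::_"
    show "?k (u - last_axis) * (\<integral>\<^sup>+w\<in>?H. ?\<Phi>1 w (half_map u w) * ennreal (?y w powr (- q)) \<partial>lborel) * indicator ?H u \<le>
        (?k (u - last_axis) * ennreal (\<bar>1 - ?y u powr a\<bar> powr p) * indicator ?H u) *
        hardy_integral p \<beta> (trial d a :: real ^ 'n::_ \<Rightarrow> complex)"
    proof (cases "u \<in> ?H")
      case True
      then have r: "0 < ?y u" by (simp add: half_space_def)
      have "(\<integral>\<^sup>+w\<in>?H. ?\<Phi>1 w (half_map u w) * ennreal (?y w powr (- q)) \<partial>lborel) \<le>
          (\<integral>\<^sup>+w. ennreal (\<bar>1 - ?y u powr a\<bar> powr p) *
            (ennreal (norm (trial d a w) powr p) * ennreal (?y w powr (- q)) * indicator ?H w) \<partial>lborel)"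
      proof (rule nn_integral_mono)
        fix w :: "real ^ 'n::_"
        show "?\<Phi>1 w (half_map u w) * ennreal (?y w powr (- q)) * indicator ?H w \<le>
            ennreal (\<bar>1 - ?y u powr a\<bar> powr p) *
            (ennreal (norm (trial d a w) powr p) * ennreal (?y w powr (- q)) * indicator ?H w)"
        proof (cases "w \<in> ?H")
          case True
          then have y: "0 < ?y w" by (simp add: half_space_def)
          have G: "0 \<le> gaussian w" "0 \<le> g (?y w)"
            by (simp_all add: gaussian_def g_def)
          have "\<bar>g (?y w) - g (?y (half_map u w))\<bar> powr p \<le> (\<bar>1 - ?y u powr a\<bar> * g (?y w)) powr p"
            using regularised_power_dilation[OF a y r, of d] p
            by (intro powr_mono2) (auto simp: g_def)
          from mult_right_mono[OF this, of "gaussian w powr p"]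
          have "\<bar>g (?y w) - g (?y (half_map u w))\<bar> powr p * gaussian w powr p \<le>
              \<bar>1 - ?y u powr a\<bar> powr p * norm (trial d a w) powr p"
            unfolding trial norm_of_real using G by (simp add: powr_mult abs_mult mult_ac)
          then have "?\<Phi>1 w (half_map u w) \<le> ennreal (\<bar>1 - ?y u powr a\<bar> powr p) * ennreal (norm (trial d a w) powr p)"
            by (simp only: ennreal_mult[symmetric] powr_ge_zero ennreal_leI)
          from mult_right_mono[OF this, of "ennreal (?y w powr (- q)) * indicator ?H w"] show ?thesis
            by (simp only: mult.assoc zero_le)
        qed simp
      qed
      also have "\<dots> = ennreal (\<bar>1 - ?y u powr a\<bar> powr p) * hardy_integral p \<beta> (trial d a :: real ^ 'n::_ \<Rightarrow> complex)"
        unfolding hardy_integral_alt q_def by (intro nn_integral_cmult) measurable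
      finally show ?thesis
        using True by (simp add: mult.assoc mult_left_mono)
    qed simp
  qed
  also have "\<dots> = ground_state_integral TYPE('n::_) p \<beta> * hardy_integral p \<beta> (trial d a :: real ^ 'n::_ \<Rightarrow> complex)"
    unfolding ground_state_integral_def q_def a_def by (intro nn_integral_multc) measurable
  finally show ?thesis
    by (simp add: add_right_mono mult_left_mono)
qed

text \<open>Near \<open>u = e\<close>, near the boundary and at infinity the finiteness is encoded in the finite seminorm of
  the Gaussian, to which the inequality applies; its Hardy integral is positive and finite.\<close>

lemma ground_state_integral_finite:
  fixes p \<beta> :: real
  assumes \<beta>: "0 < \<beta>" "\<beta> < 1" and p: "1 \<le> p" "p * \<beta> < 1"
  shows "ground_state_integral TYPE('n::{finite,linorder}) p \<beta> < \<infinity>"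
proof -
  let ?f = "\<lambda>w::real ^ 'n::_. complex_of_real (gaussian w)"
  have fin: "hardy_integral p \<beta> ?f < \<infinity>"
    using gaussian_le_decay by (intro hardy_integral_finite p \<beta>) (auto simp: gaussian_def)
  have pos: "hardy_integral p \<beta> ?f \<noteq> 0"
  proof
    assume "hardy_integral p \<beta> ?f = 0"
    then have "AE w in lborel. ennreal (norm (?f w) powr p * last_coord w powr (- p * \<beta>)) * indicator half_space w = 0"
      unfolding hardy_integral_def by (subst (asm) nn_integral_0_iff_AE) simp_all
    then have "AE w in lborel. w \<notin> (half_space :: (real ^ 'n::_) set)"
      by eventually_elim (auto simp: gaussian_def half_space_def split: split_indicator_asm)
    then have "half_space \<in> null_sets (lborel :: (real ^ 'n::_) measure)"
      by (subst AE_iff_null_sets) auto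
    then have "negligible (half_space :: (real ^ 'n::_) set)"
      by (simp add: negligible_iff_null_sets null_sets_completionI)
    moreover have "open (half_space :: (real ^ 'n::_) set)"
      unfolding half_space_def last_coord_inner by (intro open_Collect_less continuous_intros)
    moreover have "(last_axis :: real ^ 'n::_) \<in> half_space"
      by (simp add: half_space_def)
    ultimately show False
      using open_not_negligible by blast
  qed
  have q: "0 < p * \<beta>" "p * \<beta> < p"
    using \<beta> p by auto
  have "gagliardo_integral p \<beta> ?f = gaussian_remainder TYPE('n::_) p (p * \<beta>) 0"
    unfolding gagliardo_integral_def gaussian_remainder_def
  proof (rule nn_integral_cong, clarify)
    fix w w' :: "real ^ 'n::_"
    have "ennreal (norm (?f w - ?f w') powr p / norm (w - w') powr (real CARD('n::_) + p * \<beta>)) =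
        ennreal (\<bar>gaussian w - gaussian w'\<bar> powr p) * ennreal (norm (w - w') powr (- (real CARD('n::_) + p * \<beta>)))"
      unfolding of_real_diff[symmetric] norm_of_real
      by (simp only: powr_minus divide_inverse ennreal_mult powr_ge_zero inverse_nonnegative_iff_nonnegative)
    then show "ennreal (norm (?f w - ?f w') powr p / norm (w - w') powr (real CARD('n::_) + p * \<beta>)) *
        indicator (half_space \<times> half_space) (w, w') =
        ennreal (last_coord w' powr 0 * \<bar>gaussian w - gaussian w'\<bar> powr p) *
        ennreal (norm (w - w') powr (- (real CARD('n::_) + p * \<beta>))) * indicator (half_space \<times> half_space) (w, w')"
      by (cases "(w, w') \<in> half_space \<times> half_space") (auto simp: half_space_def)
  qed
  also have "\<dots> < \<infinity>"
    unfolding gaussian_remainder_def using p q by (intro weighted_gaussian_seminorm_finite) auto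
  finally have "ground_state_integral TYPE('n::_) p \<beta> * hardy_integral p \<beta> ?f < \<infinity>"
    using ground_state_integral_le_gagliardo[OF _ p(1) fin] by (simp add: order.strict_trans1)
  then show ?thesis
    using pos by (auto simp: ennreal_mult_less_top)
qed

text \<open>On the strip \<open>d \<le> y \<le> 1\<close> the regularised power is comparable to \<open>y\<^sup>a\<close>, and since
  \<open>a p - p \<beta> = -1\<close> the strip contributes a multiple of \<open>ln (1 / d)\<close>.\<close>

lemma hardy_integral_trial_unbounded:
  fixes p \<beta> K :: real
  assumes p: "1 \<le> p" "p * \<beta> < 1"
  shows "\<exists>d>0. ennreal K < hardy_integral p \<beta> (trial d (\<beta> - 1 / p) :: real ^ 'n::{finite,linorder} \<Rightarrow> complex)"
proof -
  define a where "a = \<beta> - 1 / p"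
  define q where "q = p * \<beta>"
  have qa: "q - 1 = a * p"
    using p by (simp add: q_def a_def field_simps)
  have a: "a \<le> 0"
    using p by (simp add: a_def field_simps)
  define c where "c = 2 powr (a * p / 2) * ((pi / p) powr ((real CARD('n::_) - 1) / 2) * exp (- p))"
  have c: "0 < c"
    using p by (auto simp: c_def)
  have lower: "ennreal (c * ln (1 / d)) \<le> hardy_integral p \<beta> (trial d a :: real ^ 'n::_ \<Rightarrow> complex)"
    if d: "0 < d" "d < 1" for d
  proof -
    define h where "h = (\<lambda>s::real. ennreal (1 / s) * indicator {d..1} s)"
    have [measurable]: "h \<in> borel_measurable borel"
      unfolding h_def by measurable
    have "(\<integral>\<^sup>+s. h s \<partial>lborel) = ennreal (ln 1 - ln d)"
      unfolding h_def using d by (intro nn_integral_FTC_Icc) (auto intro!: derivative_eq_intros)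
    then have "ennreal (exp (- p) * ln (1 / d)) = ennreal (exp (- p)) * (\<integral>\<^sup>+s. h s \<partial>lborel)"
      using d by (simp add: ennreal_mult[symmetric] ln_div)
    also have "\<dots> = (\<integral>\<^sup>+s. ennreal (exp (- p)) * h s \<partial>lborel)"
      by (intro nn_integral_cmult[symmetric]) measurable
    also have "\<dots> \<le> (\<integral>\<^sup>+s. h s * ennreal (exp (- p * s\<^sup>2)) \<partial>lborel)"
    proof (rule nn_integral_mono)
      fix s :: real
      have "s \<in> {d..1} \<Longrightarrow> ennreal (exp (- p)) \<le> ennreal (exp (- p * s\<^sup>2))"
        using d p by (intro ennreal_leI) (auto simp: power_le_one mult_le_cancel_left1)
      then show "ennreal (exp (- p)) * h s \<le> h s * ennreal (exp (- p * s\<^sup>2))"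
        by (cases "s \<in> {d..1}") (auto simp: h_def mult.commute intro!: mult_left_mono)
    qed
    finally have 1: "ennreal (exp (- p) * ln (1 / d)) \<le> (\<integral>\<^sup>+s. h s * ennreal (exp (- p * s\<^sup>2)) \<partial>lborel)" .
    have "ennreal (c * ln (1 / d)) = ennreal (2 powr (a * p / 2)) * (ennreal ((pi / p) powr ((real CARD('n::_) - 1) / 2)) *
        ennreal (exp (- p) * ln (1 / d)))"
      using d by (simp add: c_def ennreal_mult[symmetric] mult_ac)
    also have "\<dots> \<le> ennreal (2 powr (a * p / 2)) * (ennreal ((pi / p) powr ((real CARD('n::_) - 1) / 2)) *
        (\<integral>\<^sup>+s. h s * ennreal (exp (- p * s\<^sup>2)) \<partial>lborel))"
      by (intro mult_left_mono 1) auto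
    also have "\<dots> = ennreal (2 powr (a * p / 2)) *
        (\<integral>\<^sup>+v. h (v $ Max UNIV) * ennreal (exp (- p * (norm v)\<^sup>2)) \<partial>(lborel :: (real ^ 'n::_) measure))"
      using p by (subst nn_integral_gaussian_slice) auto
    also have "\<dots> = (\<integral>\<^sup>+v. ennreal (2 powr (a * p / 2)) *
        (h (v $ Max UNIV) * ennreal (exp (- p * (norm v)\<^sup>2))) \<partial>(lborel :: (real ^ 'n::_) measure))"
      by (intro nn_integral_cmult[symmetric]) measurable
    also have "\<dots> \<le> hardy_integral p \<beta> (trial d a :: real ^ 'n::_ \<Rightarrow> complex)"
      unfolding hardy_integral_def
    proof (rule nn_integral_mono)
      fix v :: "real ^ 'n::_"
      let ?y = "last_coord v"
      show "ennreal (2 powr (a * p / 2)) * (h (v $ Max UNIV) * ennreal (exp (- p * (norm v)\<^sup>2))) \<le>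
          ennreal (norm (trial d a v) powr p * ?y powr (- p * \<beta>)) * indicator half_space v"
      proof (cases "?y \<in> {d..1}")
        case True
        then have y: "0 < ?y" "d \<le> ?y" using d by auto
        have "(2 * ?y\<^sup>2) powr (a / 2) \<le> (d\<^sup>2 + ?y\<^sup>2) powr (a / 2)"
          using a d power_mono[OF y(2), of 2] by (intro powr_mono2') (auto simp: add_pos_nonneg)
        then have "((2 * ?y\<^sup>2) powr (a / 2)) powr p \<le> ((d\<^sup>2 + ?y\<^sup>2) powr (a / 2)) powr p"
          using p by (auto intro: powr_mono2[of p])
        moreover have "((2 * ?y\<^sup>2) powr (a / 2)) powr p = 2 powr (a * p / 2) * ?y powr (q - 1)"
          using y powr_powr[of ?y 2 "a * p / 2"] by (simp add: powr_powr powr_mult qa)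
        ultimately have "2 powr (a * p / 2) * ?y powr (q - 1) \<le> ((d\<^sup>2 + ?y\<^sup>2) powr (a / 2)) powr p"
          by simp
        then have le: "2 powr (a * p / 2) * ?y powr (q - 1) * (exp (- p * (norm v)\<^sup>2) * ?y powr (- q)) \<le>
            ((d\<^sup>2 + ?y\<^sup>2) powr (a / 2)) powr p * (exp (- p * (norm v)\<^sup>2) * ?y powr (- q))"
          by (rule mult_right_mono) simp
        have "1 / ?y = ?y powr (q - 1) * ?y powr (- q)"
          using y by (simp add: powr_diff powr_minus_divide)
        then have "2 powr (a * p / 2) * (1 / ?y * exp (- p * (norm v)\<^sup>2)) =
            2 powr (a * p / 2) * ?y powr (q - 1) * (exp (- p * (norm v)\<^sup>2) * ?y powr (- q))"
          by (simp only: mult_ac)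
        also note le
        also have "((d\<^sup>2 + ?y\<^sup>2) powr (a / 2)) powr p * (exp (- p * (norm v)\<^sup>2) * ?y powr (- q)) =
            norm (trial d a v) powr p * ?y powr (- p * \<beta>)"
          by (simp add: q_def regularised_ground_state_def gaussian_def norm_mult powr_mult powr_def[of "exp _"])
        finally have "2 powr (a * p / 2) * (1 / ?y * exp (- p * (norm v)\<^sup>2)) \<le>
            norm (trial d a v) powr p * ?y powr (- p * \<beta>)" .
        then show ?thesis
          using True y by (simp add: h_def last_coord_def[symmetric] half_space_def ennreal_mult[symmetric] ennreal_leI)
      qed (simp add: h_def last_coord_def[symmetric])
    qed
    finally show ?thesis .
  qed
  define d where "d = exp (- (\<bar>K\<bar> + 1) / c)"
  have "- (\<bar>K\<bar> + 1) / c < 0"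
    using c by (intro divide_neg_pos) auto
  then have d: "0 < d" "d < 1" "c * ln (1 / d) = \<bar>K\<bar> + 1"
    using c by (simp_all add: d_def ln_div)
  from d(3) have "ennreal K < ennreal (c * ln (1 / d))"
    by (intro ennreal_lessI) auto
  then show ?thesis
    using lower[OF d(1,2)] d(1) unfolding a_def by (meson order.strict_trans2)
qed

lemma half_space_integrals_cong:
  fixes f g :: "real ^ 'n::{finite,linorder} \<Rightarrow> complex"
  assumes "\<forall>w\<in>half_space. f w = g w"
  shows "gagliardo_integral p \<beta> f = gagliardo_integral p \<beta> g" "hardy_integral p \<beta> f = hardy_integral p \<beta> g"
  unfolding gagliardo_integral_def hardy_integral_def using assms
  by (auto intro!: nn_integral_cong split: split_indicator)

lemma schwartz_measurable: "schwartz f \<Longrightarrow> f \<in> borel_measurable borel"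
  unfolding schwartz_def
  by (intro borel_measurable_continuous_onI continuous_at_imp_continuous_on ballI differentiable_imp_continuous_within)
    (metis foldr_Nil id_apply iter_partial_def)

theorem theorem10:
  fixes p \<beta> :: real
  assumes "0 < \<beta>" and "\<beta> < 1" and "1 \<le> p" and "p < 1 / \<beta>"
  shows "(\<forall>f :: real ^ 'n::{finite,linorder} \<Rightarrow> complex. schwartz_half f \<longrightarrow>
           gagliardo_integral p \<beta> f \<ge> ennreal (hardy_const CARD('n) p \<beta>) * hardy_integral p \<beta> f) \<and>
         (\<forall>C :: real. (\<forall>f :: real ^ 'n::{finite,linorder} \<Rightarrow> complex. schwartz_half f \<longrightarrow>
           gagliardo_integral p \<beta> f \<ge> ennreal C * hardy_integral p \<beta> f) \<longrightarrow>
           C \<le> hardy_const CARD('n) p \<beta>)"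
proof (intro conjI allI impI)
  have p\<beta>: "p * \<beta> < 1" "0 < p"
    using assms by (simp_all add: field_simps)
  let ?E = "hardy_const CARD('n) p \<beta>"
  have E: "ennreal ?E = ground_state_integral TYPE('n::_) p \<beta>" "0 \<le> ?E"
    using ground_state_integral_finite[OF assms(1-3) p\<beta>(1), where 'n = 'n]
    unfolding hardy_const_eq_ground_state_integral[OF p\<beta>(2) assms(1)] by simp_all
  have fin: "hardy_integral p \<beta> f < \<infinity>" if "schwartz f" for f :: "real ^ 'n::_ \<Rightarrow> complex"
    using schwartz_decay[OF that] hardy_integral_finite[OF assms(3,1) p\<beta>(1)] by metis
  {
    fix f :: "real ^ 'n::_ \<Rightarrow> complex"
    assume "schwartz_half f"
    then obtain g where g: "schwartz g" "\<forall>w\<in>half_space. f w = g w"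
      unfolding schwartz_half_def by blast
    show "gagliardo_integral p \<beta> f \<ge> ennreal ?E * hardy_integral p \<beta> f"
      unfolding half_space_integrals_cong[OF g(2)] E(1)
      by (intro ground_state_integral_le_gagliardo schwartz_measurable fin g assms)
  }
  fix C :: real
  assume C: "\<forall>f :: real ^ 'n::_ \<Rightarrow> complex. schwartz_half f \<longrightarrow>
      gagliardo_integral p \<beta> f \<ge> ennreal C * hardy_integral p \<beta> f"
  show "C \<le> ?E"
  proof (rule ccontr)
    assume "\<not> C \<le> ?E"
    then have CE: "?E < C" by simp
    \<comment> \<open>The coefficient of the main part tends to 1 as \<open>l\<close> tends to 0.\<close>
    have "((\<lambda>l. (1 - l) powr (1 - p) * ?E) \<longlongrightarrow> (1 - 0) powr (1 - p) * ?E) (at_right 0)"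
      by (intro tendsto_intros) auto
    then have "eventually (\<lambda>l. (1 - l) powr (1 - p) * ?E < C) (at_right 0)"
      using CE by (intro order_tendstoD) auto
    moreover have "eventually (\<lambda>l::real. l \<in> {0<..<1}) (at_right 0)"
      by (intro eventually_at_right_real) auto
    ultimately have "eventually (\<lambda>l. (1 - l) powr (1 - p) * ?E < C \<and> l \<in> {0<..<1}) (at_right 0)"
      by (rule eventually_conj)
    then obtain l where l: "(1 - l) powr (1 - p) * ?E < C" "0 < l" "l < 1"
      using eventually_happens by force
    \<comment> \<open>The remainder is divided by the gap between \<open>C\<close> and this perturbed constant.\<close>
    let ?El = "(1 - l) powr (1 - p) * ?E"
    have "gaussian_remainder TYPE('n::_) p (p * \<beta>) (p * \<beta> - 1) < \<infinity>"
      unfolding gaussian_remainder_def using assms p\<beta> by (intro weighted_gaussian_seminorm_finite) auto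
    then obtain B where B: "0 \<le> B" "gaussian_remainder TYPE('n::_) p (p * \<beta>) (p * \<beta> - 1) = ennreal B"
      by (cases "gaussian_remainder TYPE('n::_) p (p * \<beta>) (p * \<beta> - 1)") auto
    obtain d where d: "0 < d"
      "ennreal (l powr (1 - p) * B / (C - ?El)) < hardy_integral p \<beta> (trial d (\<beta> - 1 / p) :: real ^ 'n::_ \<Rightarrow> complex)"
      using hardy_integral_trial_unbounded[OF assms(3) p\<beta>(1)] by blast
    let ?f = "trial d (\<beta> - 1 / p) :: real ^ 'n::_ \<Rightarrow> complex"
    have f: "schwartz ?f"
      using d(1) by (rule schwartz_trial)
    obtain A where A: "0 \<le> A" "hardy_integral p \<beta> ?f = ennreal A"
      using fin[OF f] by (cases "hardy_integral p \<beta> ?f") auto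
    have "ennreal C * hardy_integral p \<beta> ?f \<le> gagliardo_integral p \<beta> ?f"
      using f by (intro C[rule_format]) (auto simp: schwartz_half_def)
    also have "\<dots> \<le> ennreal ((1 - l) powr (1 - p)) * (ennreal ?E * hardy_integral p \<beta> ?f) +
        ennreal (l powr (1 - p)) * ennreal B"
      unfolding E(1) B(2)[symmetric] using assms p\<beta> l by (intro gagliardo_trial_le) auto
    finally have "ennreal (C * A) \<le> ennreal (?El * A + l powr (1 - p) * B)"
      unfolding A(2) using A(1) B(1) E(2) CE
      by (simp add: ennreal_mult[symmetric] ennreal_plus[symmetric] mult.assoc del: ennreal_plus)
    then have "C * A \<le> ?El * A + l powr (1 - p) * B"
      using A(1) B(1) E(2) by (subst (asm) ennreal_le_iff) auto
    then have "A \<le> l powr (1 - p) * B / (C - ?El)"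
      using l(1) by (simp add: pos_le_divide_eq algebra_simps)
    moreover have "l powr (1 - p) * B / (C - ?El) < A"
      using d(2) A B(1) l(1) by (simp add: ennreal_less_iff)
    ultimately show False by simp
  qed
qed



end
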